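(* (1) Let $\mathcal{C}$ be a closed model category and $g:X\to Y$ a morphism in $\mathcal{C}$. Then: (i) The Quillen adjunction $(g_!,g^* ):(X\downarrow\mathcal{C})\to(Y\downarrow\mathcal{C})$ is a Quillen equivalence if and only if, for every cofibrant object $u:X\to C$ of $(X\downarrow\mathcal{C})$ (equivalently, every cofibration $u$ of $\mathcal{C}$ with domain $X$), the cobase change $C\to Y\sqcup_X C$ of $g$ along $u$ is a weak equivalence in $\mathcal{C}$. (ii) The Quillen adjunction $(g_*,g^!):(\mathcal{C}\downarrow X)\to(\mathcal{C}\downarrow Y)$ is a Quillen equivalence if and only if, for every fibrant object $u:D\to Y$ of $(\mathcal{C}\downarrow Y)$ (equivalently, every fibration $u$ of $\mathcal{C}$ with codomain $Y$), the base change $X\times_Y D\to D$ of $g$ along $u$ is a weak equivalence in $\mathcal{C}$. (2) Let $\mathcal{C}$ and $\mathcal{D}$ be closed model categories and $(S,U):\mathcal{C}\to\mathcal{D}$ a Quillen equivalence (with $S$ the left adjoint). Let $X\in\mathcal{C}$ and $Y\in\mathcal{D}$ be objects. Then: (i) If $X$ is cofibrant in $\mathcal{C}$, the adjunction $(\overline{S},\overline{U}):(X\downarrow\mathcal{C})\to(S(X)\downarrow\mathcal{D})$ is a Quillen equivalence. (ii) If $Y$ is fibrant in $\mathcal{D}$, the adjunction $(\widetilde{S},\widetilde{U}):(\mathcal{C}\downarrow U(Y))\to(\mathcal{D}\downarrow Y)$ is a Quillen equivalence.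
   Context: Closed model categories are in the sense of Quillen. For an object $X$ of a category $\mathcal{C}$, the coslice category $(X\downarrow\mathcal{C})$ has as objects the morphisms $X\to C$ in $\mathcal{C}$ and as morphisms from $f:X\to C$ to $f':X\to C'$ the morphisms $\alpha:C\to C'$ with $f'=\alpha f$. The slice category $(\mathcal{C}\downarrow X)$ is defined dually. If $\mathcal{C}$ is a closed model category, $(X\downarrow\mathcal{C})$ and $(\mathcal{C}\downarrow X)$ are always given the closed model structure in which a map is a weak equivalence, cofibration or fibration if and only if its underlying map in $\mathcal{C}$ is one. For $g:X\to Y$ in $\mathcal{C}$: $g_!:(X\downarrow\mathcal{C})\to(Y\downarrow\mathcal{C})$ sends $X\to C$ to its cobase change (pushout) $Y\to Y\sqcup_X C$ along $g$, with right adjoint $g^*$ sending $Y\to D$ to the composite $X\xrightarrow{g}Y\to D$. Dually, $g_*:(\mathcal{C}\downarrow X)\to(\mathcal{C}\downarrow Y)$ sends $C\to X$ to the composite $C\to X\xrightarrow{g}Y$, with right adjoint $g^!$ sending $D\to Y$ to its base change (pullback) $X\times_Y D\to X$ along $g$. For an adjunction $(S,U):\mathcal{C}\to\mathcal{D}$ with unit $\eta$ and counit $\varepsilon$: $\overline{S}$ sends $u:X\to C$ to $S(u):S(X)\to S(C)$, and $\overline{U}$ sends $u:S(X)\to D$ to $X\xrightarrow{\eta_X}US(X)\xrightarrow{U(u)}U(D)$; $\widetilde{S}$ sends $u:C\to U(Y)$ to $S(C)\xrightarrow{S(u)}SU(Y)\xrightarrow{\varepsilon_Y}Y$, and $\widetilde{U}$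 sends $u:D\to Y$ to $U(u):U(D)\to U(Y)$. On morphisms these functors are given by $S$ and $U$ respectively. In each pair the first functor is left adjoint to the second. An adjunction $(F,G)$ between closed model categories ($F:\mathcal{C}\to\mathcal{D}$ left adjoint) is a Quillen adjunction if $F$ preserves cofibrations and acyclic cofibrations. It is a Quillen equivalence if moreover, for every cofibrant $X\in\mathcal{C}$ and fibrant $Y\in\mathcal{D}$, a map $F(X)\to Y$ is a weak equivalence in $\mathcal{D}$ if and only if its adjoint $X\to G(Y)$ is a weak equivalence in $\mathcal{C}$. *)

theory Defs
  imports Main
begin

section \<open>Categories\<close>

text \<open>A category is given by carrier sets of objects and morphisms; the operations are only
  meaningful on the carriers, and \<open>g \<cdot>\<^bsub>C\<^esub> f\<close> only when the codomain of \<open>f\<close> is the domain of \<open>g\<close>.\<close>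

record ('o, 'm) cat =
  Obj :: "'o set"
  Mor :: "'m set"
  Dom :: "'m \<Rightarrow> 'o"
  Cod :: "'m \<Rightarrow> 'o"
  Id :: "'o \<Rightarrow> 'm"
  Comp :: "'m \<Rightarrow> 'm \<Rightarrow> 'm"  (infixr "\<cdot>\<index>" 70)

definition hom :: "('o, 'm, 'z) cat_scheme \<Rightarrow> 'o \<Rightarrow> 'o \<Rightarrow> 'm set" where
  "hom C a b = {f \<in> Mor C. Dom C f = a \<and> Cod C f = b}"

locale category =
  fixes C :: "('o, 'm, 'z) cat_scheme"  (structure)
  assumes Dom_Obj: "f \<in> Mor C \<Longrightarrow> Dom C f \<in> Obj C"
    and Cod_Obj: "f \<in> Mor C \<Longrightarrow> Cod C f \<in> Obj C"
    and Id_hom: "a \<in> Obj C \<Longrightarrow> Id C a \<in> hom C a a"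
    and Comp_hom: "f \<in> hom C a b \<Longrightarrow> g \<in> hom C b c \<Longrightarrow> g \<cdot> f \<in> hom C a c"
    and Comp_Id: "f \<in> hom C a b \<Longrightarrow> f \<cdot> Id C a = f"
    and Id_Comp: "f \<in> hom C a b \<Longrightarrow> Id C b \<cdot> f = f"
    and Comp_assoc: "f \<in> hom C a b \<Longrightarrow> g \<in> hom C b c \<Longrightarrow> h \<in> hom C c d \<Longrightarrow>
      h \<cdot> (g \<cdot> f) = (h \<cdot> g) \<cdot> f"

record ('o1, 'm1, 'o2, 'm2) func =
  ob :: "'o1 \<Rightarrow> 'o2"
  mor :: "'m1 \<Rightarrow> 'm2"

definition is_functor ::
  "('o1, 'm1, 'y) cat_scheme \<Rightarrow> ('o2, 'm2, 'z) cat_scheme \<Rightarrow> ('o1, 'm1, 'o2, 'm2) func \<Rightarrow> bool"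
where
  "is_functor C D F \<longleftrightarrow>
     category C \<and> category D \<and>
     (\<forall>a\<in>Obj C. ob F a \<in> Obj D) \<and>
     (\<forall>a b. \<forall>f\<in>hom C a b. mor F f \<in> hom D (ob F a) (ob F b)) \<and>
     (\<forall>a\<in>Obj C. mor F (Id C a) = Id D (ob F a)) \<and>
     (\<forall>a b c. \<forall>f\<in>hom C a b. \<forall>g\<in>hom C b c. mor F (g \<cdot>\<^bsub>C\<^esub> f) = mor F g \<cdot>\<^bsub>D\<^esub> mor F f)"


section \<open>Finite limits and colimits\<close>

definition initial_object :: "('o, 'm, 'z) cat_scheme \<Rightarrow> 'o \<Rightarrow> bool" where
  "initial_object C i \<longleftrightarrow> i \<in> Obj C \<and> (\<forall>a\<in>Obj C. \<exists>!f. f \<in> hom C i a)"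

definition terminal_object :: "('o, 'm, 'z) cat_scheme \<Rightarrow> 'o \<Rightarrow> bool" where
  "terminal_object C t \<longleftrightarrow> t \<in> Obj C \<and> (\<forall>a\<in>Obj C. \<exists>!f. f \<in> hom C a t)"

definition cone ::
  "('i, 'j, 'y) cat_scheme \<Rightarrow> ('o, 'm, 'z) cat_scheme \<Rightarrow> ('i, 'j, 'o, 'm) func \<Rightarrow> 'o \<Rightarrow> ('i \<Rightarrow> 'm) \<Rightarrow> bool"
where
  "cone J C F l p \<longleftrightarrow>
     l \<in> Obj C \<and> (\<forall>j\<in>Obj J. p j \<in> hom C l (ob F j)) \<and>
     (\<forall>j k. \<forall>s\<in>hom J j k. mor F s \<cdot>\<^bsub>C\<^esub> p j = p k)"

definition limit_cone ::
  "('i, 'j, 'y) cat_scheme \<Rightarrow> ('o, 'm, 'z) cat_scheme \<Rightarrow> ('i, 'j, 'o, 'm) func \<Rightarrow> 'o \<Rightarrow> ('i \<Rightarrow> 'm) \<Rightarrow> bool"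
where
  "limit_cone J C F l p \<longleftrightarrow>
     cone J C F l p \<and>
     (\<forall>c q. cone J C F c q \<longrightarrow> (\<exists>!h. h \<in> hom C c l \<and> (\<forall>j\<in>Obj J. p j \<cdot>\<^bsub>C\<^esub> h = q j)))"

definition cocone ::
  "('i, 'j, 'y) cat_scheme \<Rightarrow> ('o, 'm, 'z) cat_scheme \<Rightarrow> ('i, 'j, 'o, 'm) func \<Rightarrow> 'o \<Rightarrow> ('i \<Rightarrow> 'm) \<Rightarrow> bool"
where
  "cocone J C F l p \<longleftrightarrow>
     l \<in> Obj C \<and> (\<forall>j\<in>Obj J. p j \<in> hom C (ob F j) l) \<and>
     (\<forall>j k. \<forall>s\<in>hom J j k. p k \<cdot>\<^bsub>C\<^esub> mor F s = p j)"

definition colimit_cocone ::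
  "('i, 'j, 'y) cat_scheme \<Rightarrow> ('o, 'm, 'z) cat_scheme \<Rightarrow> ('i, 'j, 'o, 'm) func \<Rightarrow> 'o \<Rightarrow> ('i \<Rightarrow> 'm) \<Rightarrow> bool"
where
  "colimit_cocone J C F l p \<longleftrightarrow>
     cocone J C F l p \<and>
     (\<forall>c q. cocone J C F c q \<longrightarrow> (\<exists>!h. h \<in> hom C l c \<and> (\<forall>j\<in>Obj J. h \<cdot>\<^bsub>C\<^esub> p j = q j)))"

text \<open>Every finite category is isomorphic to one whose objects and morphisms are natural numbers,
  so it suffices to let the index category \<open>J\<close> range over those.\<close>

definition has_finite_limits :: "('o, 'm, 'z) cat_scheme \<Rightarrow> bool" where
  "has_finite_limits C \<longleftrightarrow>
     (\<forall>(J :: (nat, nat) cat) F. finite (Obj J) \<and> finite (Mor J) \<and> is_functor J C F \<longrightarrow>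
        (\<exists>l p. limit_cone J C F l p))"

definition has_finite_colimits :: "('o, 'm, 'z) cat_scheme \<Rightarrow> bool" where
  "has_finite_colimits C \<longleftrightarrow>
     (\<forall>(J :: (nat, nat) cat) F. finite (Obj J) \<and> finite (Mor J) \<and> is_functor J C F \<longrightarrow>
        (\<exists>l p. colimit_cocone J C F l p))"

text \<open>\<open>pushout C f g i j\<close>: for \<open>f : x \<rightarrow> a\<close> and \<open>g : x \<rightarrow> b\<close>, the maps \<open>i : a \<rightarrow> p\<close> and \<open>j : b \<rightarrow> p\<close>
  form a pushout square; \<open>j\<close> is then the cobase change of \<open>f\<close> along \<open>g\<close>.\<close>

definition pushout :: "('o, 'm, 'z) cat_scheme \<Rightarrow> 'm \<Rightarrow> 'm \<Rightarrow> 'm \<Rightarrow> 'm \<Rightarrow> bool" where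
  "pushout C f g i j \<longleftrightarrow>
     (\<exists>x a b p. f \<in> hom C x a \<and> g \<in> hom C x b \<and> i \<in> hom C a p \<and> j \<in> hom C b p \<and>
        i \<cdot>\<^bsub>C\<^esub> f = j \<cdot>\<^bsub>C\<^esub> g \<and>
        (\<forall>q i' j'. i' \<in> hom C a q \<and> j' \<in> hom C b q \<and> i' \<cdot>\<^bsub>C\<^esub> f = j' \<cdot>\<^bsub>C\<^esub> g \<longrightarrow>
           (\<exists>!h. h \<in> hom C p q \<and> h \<cdot>\<^bsub>C\<^esub> i = i' \<and> h \<cdot>\<^bsub>C\<^esub> j = j')))"

text \<open>\<open>pullback C f g p q\<close>: for \<open>f : a \<rightarrow> x\<close> and \<open>g : b \<rightarrow> x\<close>, the maps \<open>p : w \<rightarrow> a\<close> and \<open>q : w \<rightarrow> b\<close>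
  form a pullback square; \<open>q\<close> is then the base change of \<open>f\<close> along \<open>g\<close>.\<close>

definition pullback :: "('o, 'm, 'z) cat_scheme \<Rightarrow> 'm \<Rightarrow> 'm \<Rightarrow> 'm \<Rightarrow> 'm \<Rightarrow> bool" where
  "pullback C f g p q \<longleftrightarrow>
     (\<exists>x a b w. f \<in> hom C a x \<and> g \<in> hom C b x \<and> p \<in> hom C w a \<and> q \<in> hom C w b \<and>
        f \<cdot>\<^bsub>C\<^esub> p = g \<cdot>\<^bsub>C\<^esub> q \<and>
        (\<forall>c p' q'. p' \<in> hom C c a \<and> q' \<in> hom C c b \<and> f \<cdot>\<^bsub>C\<^esub> p' = g \<cdot>\<^bsub>C\<^esub> q' \<longrightarrow>
           (\<exists>!h. h \<in> hom C c w \<and> p \<cdot>\<^bsub>C\<^esub> h = p' \<and> q \<cdot>\<^bsub>C\<^esub> h = q')))"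


section \<open>Closed model categories\<close>

record ('o, 'm) model_cat = "('o, 'm) cat" +
  weq :: "'m set"
  cof :: "'m set"
  fib :: "'m set"

definition retract_of :: "('o, 'm, 'z) cat_scheme \<Rightarrow> 'm \<Rightarrow> 'm \<Rightarrow> bool" where
  "retract_of C f g \<longleftrightarrow>
     (\<exists>a b c d. \<exists>s\<in>hom C a c. \<exists>r\<in>hom C c a. \<exists>s'\<in>hom C b d. \<exists>r'\<in>hom C d b.
        f \<in> hom C a b \<and> g \<in> hom C c d \<and>
        r \<cdot>\<^bsub>C\<^esub> s = Id C a \<and> r' \<cdot>\<^bsub>C\<^esub> s' = Id C b \<and>
        g \<cdot>\<^bsub>C\<^esub> s = s' \<cdot>\<^bsub>C\<^esub> f \<and> f \<cdot>\<^bsub>C\<^esub> r = r' \<cdot>\<^bsub>C\<^esub> g)"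

definition has_lifting :: "('o, 'm, 'z) cat_scheme \<Rightarrow> 'm \<Rightarrow> 'm \<Rightarrow> bool" where
  "has_lifting C i p \<longleftrightarrow>
     (\<forall>u\<in>hom C (Dom C i) (Dom C p). \<forall>v\<in>hom C (Cod C i) (Cod C p).
        p \<cdot>\<^bsub>C\<^esub> u = v \<cdot>\<^bsub>C\<^esub> i \<longrightarrow>
        (\<exists>h\<in>hom C (Cod C i) (Dom C p). h \<cdot>\<^bsub>C\<^esub> i = u \<and> p \<cdot>\<^bsub>C\<^esub> h = v))"

text \<open>Quillen's axioms CM1--CM5 (Rational homotopy theory, 1969): only finite limits and colimits
  are required, and the factorizations need not be functorial.\<close>

locale closed_model_category = category C
  for C :: "('o, 'm, 'z) model_cat_scheme"  (structure) +
  assumes weq_Mor: "weq C \<subseteq> Mor C"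
    and cof_Mor: "cof C \<subseteq> Mor C"
    and fib_Mor: "fib C \<subseteq> Mor C"
    and CM1_limits: "has_finite_limits C"
    and CM1_colimits: "has_finite_colimits C"
    and CM2_comp: "f \<in> hom C a b \<Longrightarrow> g \<in> hom C b c \<Longrightarrow> f \<in> weq C \<Longrightarrow> g \<in> weq C \<Longrightarrow> g \<cdot> f \<in> weq C"
    and CM2_left: "f \<in> hom C a b \<Longrightarrow> g \<in> hom C b c \<Longrightarrow> f \<in> weq C \<Longrightarrow> g \<cdot> f \<in> weq C \<Longrightarrow> g \<in> weq C"
    and CM2_right: "f \<in> hom C a b \<Longrightarrow> g \<in> hom C b c \<Longrightarrow> g \<in> weq C \<Longrightarrow> g \<cdot> f \<in> weq C \<Longrightarrow> f \<in> weq C"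
    and CM3_weq: "retract_of C f g \<Longrightarrow> g \<in> weq C \<Longrightarrow> f \<in> weq C"
    and CM3_cof: "retract_of C f g \<Longrightarrow> g \<in> cof C \<Longrightarrow> f \<in> cof C"
    and CM3_fib: "retract_of C f g \<Longrightarrow> g \<in> fib C \<Longrightarrow> f \<in> fib C"
    and CM4_acyclic_cof: "i \<in> cof C \<inter> weq C \<Longrightarrow> p \<in> fib C \<Longrightarrow> has_lifting C i p"
    and CM4_acyclic_fib: "i \<in> cof C \<Longrightarrow> p \<in> fib C \<inter> weq C \<Longrightarrow> has_lifting C i p"
    and CM5_acyclic_cof: "f \<in> hom C a b \<Longrightarrow>
      \<exists>c. \<exists>i\<in>hom C a c. \<exists>p\<in>hom C c b. i \<in> cof C \<inter> weq C \<and> p \<in> fib C \<and> f = p \<cdot> i"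
    and CM5_acyclic_fib: "f \<in> hom C a b \<Longrightarrow>
      \<exists>c. \<exists>i\<in>hom C a c. \<exists>p\<in>hom C c b. i \<in> cof C \<and> p \<in> fib C \<inter> weq C \<and> f = p \<cdot> i"

definition cofibrant :: "('o, 'm, 'z) model_cat_scheme \<Rightarrow> 'o \<Rightarrow> bool" where
  "cofibrant C a \<longleftrightarrow> (\<exists>i f. initial_object C i \<and> f \<in> hom C i a \<and> a \<in> Obj C \<and> f \<in> cof C)"

definition fibrant :: "('o, 'm, 'z) model_cat_scheme \<Rightarrow> 'o \<Rightarrow> bool" where
  "fibrant C a \<longleftrightarrow> (\<exists>t f. terminal_object C t \<and> f \<in> hom C a t \<and> a \<in> Obj C \<and> f \<in> fib C)"


section \<open>Adjunctions, Quillen adjunctions and Quillen equivalences\<close>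

record ('o1, 'm1, 'o2, 'm2) adj =
  left :: "('o1, 'm1, 'o2, 'm2) func"
  right :: "('o2, 'm2, 'o1, 'm1) func"
  unit :: "'o1 \<Rightarrow> 'm1"
  counit :: "'o2 \<Rightarrow> 'm2"

definition adjunction ::
  "('o1, 'm1, 'y) cat_scheme \<Rightarrow> ('o2, 'm2, 'z) cat_scheme \<Rightarrow> ('o1, 'm1, 'o2, 'm2) adj \<Rightarrow> bool"
where
  "adjunction C D A \<longleftrightarrow>
     is_functor C D (left A) \<and> is_functor D C (right A) \<and>
     (\<forall>a\<in>Obj C. unit A a \<in> hom C a (ob (right A) (ob (left A) a))) \<and>
     (\<forall>a b. \<forall>f\<in>hom C a b. mor (right A) (mor (left A) f) \<cdot>\<^bsub>C\<^esub> unit A a = unit A b \<cdot>\<^bsub>C\<^esub> f) \<and>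
     (\<forall>a\<in>Obj D. counit A a \<in> hom D (ob (left A) (ob (right A) a)) a) \<and>
     (\<forall>a b. \<forall>f\<in>hom D a b. f \<cdot>\<^bsub>D\<^esub> counit A a = counit A b \<cdot>\<^bsub>D\<^esub> mor (left A) (mor (right A) f)) \<and>
     (\<forall>a\<in>Obj C. counit A (ob (left A) a) \<cdot>\<^bsub>D\<^esub> mor (left A) (unit A a) = Id D (ob (left A) a)) \<and>
     (\<forall>a\<in>Obj D. mor (right A) (counit A a) \<cdot>\<^bsub>C\<^esub> unit A (ob (right A) a) = Id C (ob (right A) a))"

definition quillen_adjunction ::
  "('o1, 'm1, 'y) model_cat_scheme \<Rightarrow> ('o2, 'm2, 'z) model_cat_scheme \<Rightarrow>
   ('o1, 'm1, 'o2, 'm2) adj \<Rightarrow> bool"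
where
  "quillen_adjunction C D A \<longleftrightarrow>
     closed_model_category C \<and> closed_model_category D \<and> adjunction C D A \<and>
     (\<forall>f\<in>cof C. mor (left A) f \<in> cof D) \<and>
     (\<forall>f\<in>cof C \<inter> weq C. mor (left A) f \<in> cof D \<inter> weq D)"

text \<open>The adjoint of \<open>f : F(x) \<rightarrow> y\<close> is \<open>G(f) \<cdot> \<eta>\<^sub>x : x \<rightarrow> G(y)\<close>.\<close>

definition quillen_equivalence ::
  "('o1, 'm1, 'y) model_cat_scheme \<Rightarrow> ('o2, 'm2, 'z) model_cat_scheme \<Rightarrow>
   ('o1, 'm1, 'o2, 'm2) adj \<Rightarrow> bool"
where
  "quillen_equivalence C D A \<longleftrightarrow>
     quillen_adjunction C D A \<and>
     (\<forall>x y. cofibrant C x \<and> fibrant D y \<longrightarrow>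
        (\<forall>f\<in>hom D (ob (left A) x) y. f \<in> weq D \<longleftrightarrow> mor (right A) f \<cdot>\<^bsub>C\<^esub> unit A x \<in> weq C))"


section \<open>Coslice and slice categories\<close>

text \<open>A morphism \<open>\<alpha>\<close> from \<open>f\<close> to \<open>f'\<close> is encoded as the triple \<open>(f, \<alpha>, f')\<close>, since \<open>\<alpha>\<close> alone
  does not determine its domain and codomain.\<close>

definition coslice :: "('o, 'm, 'z) cat_scheme \<Rightarrow> 'o \<Rightarrow> ('m, 'm \<times> 'm \<times> 'm) cat" where
  "coslice C X =
     \<lparr> Obj = {f \<in> Mor C. Dom C f = X},
       Mor = {(f, \<alpha>, f'). f \<in> Mor C \<and> Dom C f = X \<and> f' \<in> Mor C \<and> Dom C f' = X \<and>
                \<alpha> \<in> hom C (Cod C f) (Cod C f') \<and> f' = \<alpha> \<cdot>\<^bsub>C\<^esub> f},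
       Dom = (\<lambda>(f, \<alpha>, f'). f),
       Cod = (\<lambda>(f, \<alpha>, f'). f'),
       Id = (\<lambda>f. (f, Id C (Cod C f), f)),
       Comp = (\<lambda>(f', \<beta>, f'') (f, \<alpha>, _). (f, \<beta> \<cdot>\<^bsub>C\<^esub> \<alpha>, f'')) \<rparr>"

definition slice :: "('o, 'm, 'z) cat_scheme \<Rightarrow> 'o \<Rightarrow> ('m, 'm \<times> 'm \<times> 'm) cat" where
  "slice C X =
     \<lparr> Obj = {f \<in> Mor C. Cod C f = X},
       Mor = {(f, \<alpha>, f'). f \<in> Mor C \<and> Cod C f = X \<and> f' \<in> Mor C \<and> Cod C f' = X \<and>
                \<alpha> \<in> hom C (Dom C f) (Dom C f') \<and> f = f' \<cdot>\<^bsub>C\<^esub> \<alpha>},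
       Dom = (\<lambda>(f, \<alpha>, f'). f),
       Cod = (\<lambda>(f, \<alpha>, f'). f'),
       Id = (\<lambda>f. (f, Id C (Dom C f), f)),
       Comp = (\<lambda>(f', \<beta>, f'') (f, \<alpha>, _). (f, \<beta> \<cdot>\<^bsub>C\<^esub> \<alpha>, f'')) \<rparr>"

definition coslice_model ::
  "('o, 'm, 'z) model_cat_scheme \<Rightarrow> 'o \<Rightarrow> ('m, 'm \<times> 'm \<times> 'm) model_cat"
where
  "coslice_model C X =
     cat.extend (coslice C X)
       (model_cat.fields
         {(f, \<alpha>, f') \<in> Mor (coslice C X). \<alpha> \<in> weq C}
         {(f, \<alpha>, f') \<in> Mor (coslice C X). \<alpha> \<in> cof C}
         {(f, \<alpha>, f') \<in> Mor (coslice C X). \<alpha> \<in> fib C})"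

definition slice_model ::
  "('o, 'm, 'z) model_cat_scheme \<Rightarrow> 'o \<Rightarrow> ('m, 'm \<times> 'm \<times> 'm) model_cat"
where
  "slice_model C X =
     cat.extend (slice C X)
       (model_cat.fields
         {(f, \<alpha>, f') \<in> Mor (slice C X). \<alpha> \<in> weq C}
         {(f, \<alpha>, f') \<in> Mor (slice C X). \<alpha> \<in> cof C}
         {(f, \<alpha>, f') \<in> Mor (slice C X). \<alpha> \<in> fib C})"


section \<open>Change of the base object along a morphism\<close>

text \<open>The functor \<open>g\<^sub>!\<close> depends on a choice of pushouts: for \<open>g : X \<rightarrow> Y\<close> and each \<open>u : X \<rightarrow> C\<close>,
  maps \<open>i u : Y \<rightarrow> Y \<squnion>\<^sub>X C\<close> and \<open>j u : C \<rightarrow> Y \<squnion>\<^sub>X C\<close>. The latter is the cobase change of \<open>g\<close> along \<open>u\<close>.\<close>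

definition pushout_choice :: "('o, 'm, 'z) cat_scheme \<Rightarrow> 'm \<Rightarrow> ('m \<Rightarrow> 'm) \<Rightarrow> ('m \<Rightarrow> 'm) \<Rightarrow> bool" where
  "pushout_choice C g i j \<longleftrightarrow> (\<forall>u\<in>Obj (coslice C (Dom C g)). pushout C g u (i u) (j u))"

text \<open>The adjunction \<open>(g\<^sub>!, g\<^sup>*)\<close>.\<close>

definition cobase_change_adj ::
  "('o, 'm, 'z) cat_scheme \<Rightarrow> 'm \<Rightarrow> ('m \<Rightarrow> 'm) \<Rightarrow> ('m \<Rightarrow> 'm) \<Rightarrow>
   ('m, 'm \<times> 'm \<times> 'm, 'm, 'm \<times> 'm \<times> 'm) adj"
where
  "cobase_change_adj C g i j =
     \<lparr> left = \<lparr> ob = i,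
                mor = (\<lambda>(u, \<alpha>, u').
                  (i u,
                   THE h. h \<in> hom C (Cod C (i u)) (Cod C (i u')) \<and>
                          h \<cdot>\<^bsub>C\<^esub> i u = i u' \<and> h \<cdot>\<^bsub>C\<^esub> j u = j u' \<cdot>\<^bsub>C\<^esub> \<alpha>,
                   i u')) \<rparr>,
       right = \<lparr> ob = (\<lambda>v. v \<cdot>\<^bsub>C\<^esub> g),
                 mor = (\<lambda>(v, \<beta>, v'). (v \<cdot>\<^bsub>C\<^esub> g, \<beta>, v' \<cdot>\<^bsub>C\<^esub> g)) \<rparr>,
       unit = (\<lambda>u. (u, j u, i u \<cdot>\<^bsub>C\<^esub> g)),
       counit = (\<lambda>v.
         (i (v \<cdot>\<^bsub>C\<^esub> g),
          THE h. h \<in> hom C (Cod C (i (v \<cdot>\<^bsub>C\<^esub> g))) (Cod C v) \<and>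
                 h \<cdot>\<^bsub>C\<^esub> i (v \<cdot>\<^bsub>C\<^esub> g) = v \<and> h \<cdot>\<^bsub>C\<^esub> j (v \<cdot>\<^bsub>C\<^esub> g) = Id C (Cod C v),
          v)) \<rparr>"

text \<open>Dually, for \<open>g : X \<rightarrow> Y\<close> and each \<open>v : D \<rightarrow> Y\<close>, maps \<open>p v : X \<times>\<^sub>Y D \<rightarrow> X\<close> and
  \<open>q v : X \<times>\<^sub>Y D \<rightarrow> D\<close>. The latter is the base change of \<open>g\<close> along \<open>v\<close>.\<close>

definition pullback_choice :: "('o, 'm, 'z) cat_scheme \<Rightarrow> 'm \<Rightarrow> ('m \<Rightarrow> 'm) \<Rightarrow> ('m \<Rightarrow> 'm) \<Rightarrow> bool" where
  "pullback_choice C g p q \<longleftrightarrow> (\<forall>v\<in>Obj (slice C (Cod C g)). pullback C g v (p v) (q v))"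

text \<open>The adjunction \<open>(g\<^sub>*, g\<^sup>!)\<close>.\<close>

definition base_change_adj ::
  "('o, 'm, 'z) cat_scheme \<Rightarrow> 'm \<Rightarrow> ('m \<Rightarrow> 'm) \<Rightarrow> ('m \<Rightarrow> 'm) \<Rightarrow>
   ('m, 'm \<times> 'm \<times> 'm, 'm, 'm \<times> 'm \<times> 'm) adj"
where
  "base_change_adj C g p q =
     \<lparr> left = \<lparr> ob = (\<lambda>u. g \<cdot>\<^bsub>C\<^esub> u),
                mor = (\<lambda>(u, \<alpha>, u'). (g \<cdot>\<^bsub>C\<^esub> u, \<alpha>, g \<cdot>\<^bsub>C\<^esub> u')) \<rparr>,
       right = \<lparr> ob = p,
                 mor = (\<lambda>(v, \<beta>, v').
                   (p v,
                    THE h. h \<in> hom C (Dom C (p v)) (Dom C (p v')) \<and>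
                           p v' \<cdot>\<^bsub>C\<^esub> h = p v \<and> q v' \<cdot>\<^bsub>C\<^esub> h = \<beta> \<cdot>\<^bsub>C\<^esub> q v,
                    p v')) \<rparr>,
       unit = (\<lambda>u.
         (u,
          THE h. h \<in> hom C (Dom C u) (Dom C (p (g \<cdot>\<^bsub>C\<^esub> u))) \<and>
                 p (g \<cdot>\<^bsub>C\<^esub> u) \<cdot>\<^bsub>C\<^esub> h = u \<and> q (g \<cdot>\<^bsub>C\<^esub> u) \<cdot>\<^bsub>C\<^esub> h = Id C (Dom C u),
          p (g \<cdot>\<^bsub>C\<^esub> u))),
       counit = (\<lambda>v. (g \<cdot>\<^bsub>C\<^esub> p v, q v, v)) \<rparr>"


section \<open>Adjunctions induced on coslices and slices\<close>

text \<open>For an adjunction \<open>(S, U)\<close>, its unit and counit also underlie those of the induced adjunctions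
  \<open>(X \<down> C) \<rightarrow> (S(X) \<down> D)\<close> and \<open>(C \<down> U(Y)) \<rightarrow> (D \<down> Y)\<close>.\<close>

definition coslice_adj ::
  "('o1, 'm1, 'y) cat_scheme \<Rightarrow> ('o2, 'm2, 'z) cat_scheme \<Rightarrow> ('o1, 'm1, 'o2, 'm2) adj \<Rightarrow> 'o1 \<Rightarrow>
   ('m1, 'm1 \<times> 'm1 \<times> 'm1, 'm2, 'm2 \<times> 'm2 \<times> 'm2) adj"
where
  "coslice_adj C D A X =
     (let S = left A; U = right A;
          Sbar = (\<lambda>u. mor S u);
          Ubar = (\<lambda>v. mor U v \<cdot>\<^bsub>C\<^esub> unit A X)
      in \<lparr> left = \<lparr> ob = Sbar, mor = (\<lambda>(u, \<alpha>, u'). (Sbar u, mor S \<alpha>, Sbar u')) \<rparr>,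
           right = \<lparr> ob = Ubar, mor = (\<lambda>(v, \<beta>, v'). (Ubar v, mor U \<beta>, Ubar v')) \<rparr>,
           unit = (\<lambda>u. (u, unit A (Cod C u), Ubar (Sbar u))),
           counit = (\<lambda>v. (Sbar (Ubar v), counit A (Cod D v), v)) \<rparr>)"

definition slice_adj ::
  "('o1, 'm1, 'y) cat_scheme \<Rightarrow> ('o2, 'm2, 'z) cat_scheme \<Rightarrow> ('o1, 'm1, 'o2, 'm2) adj \<Rightarrow> 'o2 \<Rightarrow>
   ('m1, 'm1 \<times> 'm1 \<times> 'm1, 'm2, 'm2 \<times> 'm2 \<times> 'm2) adj"
where
  "slice_adj C D A Y =
     (let S = left A; U = right A;
          Stilde = (\<lambda>u. counit A Y \<cdot>\<^bsub>D\<^esub> mor S u);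
          Utilde = (\<lambda>v. mor U v)
      in \<lparr> left = \<lparr> ob = Stilde, mor = (\<lambda>(u, \<alpha>, u'). (Stilde u, mor S \<alpha>, Stilde u')) \<rparr>,
           right = \<lparr> ob = Utilde, mor = (\<lambda>(v, \<beta>, v'). (Utilde v, mor U \<beta>, Utilde v')) \<rparr>,
           unit = (\<lambda>u. (u, unit A (Dom C u), Utilde (Stilde u))),
           counit = (\<lambda>v. (Stilde (Utilde v), counit A (Dom D v), v)) \<rparr>)"

end

theory Submission
  imports Defs
begin

text \<open>Everything concerning slices follows from the case of coslices in the opposite category. For
  \<open>(g\<^sub>!, g\<^sup>*)\<close>, the adjoint of \<open>f : g\<^sub>!(u) \<rightarrow> v\<close> is \<open>f\<close> composed with the cobase change of \<open>g\<close> along \<open>u\<close>,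
  so two-out-of-three gives one direction, and the choice of a fibrant replacement of \<open>g\<^sub>!(u)\<close> for
  \<open>f\<close> gives the other. For \<open>(S, U)\<close>, a cofibrant object of a coslice under a cofibrant object has
  cofibrant codomain, a fibrant object of a coslice has fibrant codomain, and adjoints in the
  coslices are adjoints for \<open>(S, U)\<close>.\<close>


section \<open>Duality\<close>

text \<open>A Quillen adjunction is defined by what its left adjoint preserves, so its invariance
  under duality is not formal. It rests on the retract argument: a map that lifts against all
  acyclic fibrations (all fibrations) is a cofibration (an acyclic cofibration), and lifting
  problems transpose along an adjunction. The other obstacle is that coslices must be shown to be
  closed model categories. Limits, liftings and factorizations come from \<open>C\<close> once the
  structure map from \<open>X\<close> is carried along. Colimits do not: the empty colimit, for
  example, is the identity of \<open>X\<close> and not the initial object of \<open>C\<close>. They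
  are computed in \<open>C\<close> over an enlarged index category in which \<open>X\<close> takes
  part in the diagram.\<close>

lemma (in category) hom_ObjD: "f \<in> hom C a b \<Longrightarrow> a \<in> Obj C" "f \<in> hom C a b \<Longrightarrow> b \<in> Obj C"
  using Dom_Obj Cod_Obj by (auto simp: hom_def)

text \<open>A record update keeps the types and all further fields, so dualising twice returns the
  very same record and results can be carried back by rewriting.\<close>

definition op_cat :: "('o, 'm, 'z) cat_scheme \<Rightarrow> ('o, 'm, 'z) cat_scheme" where
  "op_cat C = C\<lparr>Dom := Cod C, Cod := Dom C, Comp := \<lambda>g f. f \<cdot>\<^bsub>C\<^esub> g\<rparr>"

definition op_model :: "('o, 'm, 'z) model_cat_scheme \<Rightarrow> ('o, 'm, 'z) model_cat_scheme" where
  "op_model C = (op_cat C)\<lparr>cof := fib C, fib := cof C\<rparr>"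

text \<open>A functor acts on opposite categories by the same maps on objects and morphisms; only
  the roles within the adjunction are exchanged.\<close>

definition op_adj :: "('o1, 'm1, 'o2, 'm2) adj \<Rightarrow> ('o2, 'm2, 'o1, 'm1) adj" where
  "op_adj A = \<lparr>left = right A, right = left A, unit = counit A, counit = unit A\<rparr>"

lemma op_cat_simps [simp]:
  "Obj (op_cat C) = Obj C" "Mor (op_cat C) = Mor C" "Dom (op_cat C) = Cod C"
  "Cod (op_cat C) = Dom C" "Id (op_cat C) = Id C" "g \<cdot>\<^bsub>op_cat C\<^esub> f = f \<cdot>\<^bsub>C\<^esub> g"
  by (simp_all add: op_cat_def)

lemma op_model_simps [simp]:
  "Obj (op_model C) = Obj C" "Mor (op_model C) = Mor C" "Dom (op_model C) = Cod C"
  "Cod (op_model C) = Dom C" "Id (op_model C) = Id C" "g \<cdot>\<^bsub>op_model C\<^esub> f = f \<cdot>\<^bsub>C\<^esub> g"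
  "weq (op_model C) = weq C" "cof (op_model C) = fib C" "fib (op_model C) = cof C"
  by (simp_all add: op_model_def op_cat_def)

lemma op_adj_simps [simp]:
  "left (op_adj A) = right A" "right (op_adj A) = left A"
  "unit (op_adj A) = counit A" "counit (op_adj A) = unit A"
  by (simp_all add: op_adj_def)

lemma hom_op [simp]:
  "hom (op_cat C) a b = hom C b a" "hom (op_model C') a b = hom C' b a"
  by (auto simp: hom_def)

lemma op_op [simp]:
  "op_cat (op_cat C) = C" "op_model (op_model C') = C'" "op_adj (op_adj A) = A"
  by (simp_all add: op_cat_def op_model_def op_adj_def)

lemma category_op_cat:
  assumes "category C"
  shows "category (op_cat C)"
proof -
  interpret category C by fact
  show ?thesis
    by unfold_locales
      (auto simp: Dom_Obj Cod_Obj Id_hom Comp_Id Id_Comp intro: Comp_hom Comp_assoc[symmetric])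
qed

lemma category_op_cat_iff [simp]: "category (op_cat C) \<longleftrightarrow> category C"
  using category_op_cat[of C] category_op_cat[of "op_cat C"] by auto

lemma category_op_model_iff [simp]: "category (op_model C) \<longleftrightarrow> category C"
proof -
  have "category (op_model C) \<longleftrightarrow> category (op_cat C)"
    by (simp add: category_def)
  then show ?thesis by simp
qed

section \<open>Limits, lifting and the model axioms in the opposite category\<close>

lemma is_functor_op_index: "is_functor J (op_model C) F \<longleftrightarrow> is_functor (op_cat J) C F"
  unfolding is_functor_def by (simp, intro conj_cong refl) blast+

lemma is_functor_op: "is_functor (op_model C) (op_model D) F \<longleftrightarrow> is_functor C D F"
  unfolding is_functor_def by (simp, intro conj_cong refl) blast+

lemma limit_cone_op: "limit_cone J (op_model C) F l p \<longleftrightarrow> colimit_cocone (op_cat J) C F l p"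
  unfolding limit_cone_def colimit_cocone_def cone_def cocone_def by simp blast

lemma colimit_cocone_op: "colimit_cocone J (op_model C) F l p \<longleftrightarrow> limit_cone (op_cat J) C F l p"
  unfolding limit_cone_def colimit_cocone_def cone_def cocone_def by simp blast

text \<open>The diagram is left alone and its index category is dualised instead. The finite
  categories on natural numbers are closed under \<open>op_cat\<close>, which changes neither
  objects nor morphisms.\<close>

lemma has_finite_limits_op: "has_finite_colimits C \<Longrightarrow> has_finite_limits (op_model C)"
  unfolding has_finite_limits_def has_finite_colimits_def limit_cone_op is_functor_op_index
  by (metis op_cat_simps(1,2))

lemma has_finite_colimits_op: "has_finite_limits C \<Longrightarrow> has_finite_colimits (op_model C)"
  unfolding has_finite_limits_def has_finite_colimits_def colimit_cocone_op is_functor_op_index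
  by (metis op_cat_simps(1,2))

lemma initial_terminal_op [simp]:
  "initial_object (op_model C) = terminal_object C"
  "terminal_object (op_model C) = initial_object C"
  by (auto simp: initial_object_def terminal_object_def fun_eq_iff)

lemma cofibrant_fibrant_op [simp]:
  "cofibrant (op_model C) = fibrant C" "fibrant (op_model C) = cofibrant C"
  by (auto simp: cofibrant_def fibrant_def fun_eq_iff)

text \<open>Reversing arrows turns inclusions into retractions and exchanges the two ends of each
  map, so the witnesses become \<open>r'\<close>, \<open>s'\<close>, \<open>r\<close>,
  \<open>s\<close> in this order.\<close>

lemma retract_of_op:
  assumes "retract_of (op_model C) f g"
  shows "retract_of C f g"
proof -
  obtain a b c d s r s' r' where *: "s \<in> hom C c a" "r \<in> hom C a c" "s' \<in> hom C d b" "r' \<in> hom C b d"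
    "f \<in> hom C b a" "g \<in> hom C d c" "s \<cdot>\<^bsub>C\<^esub> r = Id C a" "s' \<cdot>\<^bsub>C\<^esub> r' = Id C b"
    "s \<cdot>\<^bsub>C\<^esub> g = f \<cdot>\<^bsub>C\<^esub> s'" "r \<cdot>\<^bsub>C\<^esub> f = g \<cdot>\<^bsub>C\<^esub> r'"
    using assms unfolding retract_of_def by auto
  show ?thesis
    unfolding retract_of_def
    by (rule exI[of _ b], rule exI[of _ a], rule exI[of _ d], rule exI[of _ c],
        rule bexI[of _ r'], rule bexI[of _ s'], rule bexI[of _ r], rule bexI[of _ s])
      (use * in simp_all)
qed

lemma has_lifting_op: "has_lifting C p i \<Longrightarrow> has_lifting (op_model C) i p"
  unfolding has_lifting_def by simp metis

lemma closed_model_category_op: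
  assumes "closed_model_category C"
  shows "closed_model_category (op_model C)"
proof -
  interpret closed_model_category C by fact
  show ?thesis
  proof (intro closed_model_category.intro closed_model_category_axioms.intro)
    show "category (op_model C)"
      by (simp add: category_axioms)
    fix f g a b
    { assume "f \<in> hom (op_model C) a b"
      then have *: "f \<in> hom C b a" by simp
      show "\<exists>c. \<exists>i\<in>hom (op_model C) a c. \<exists>p\<in>hom (op_model C) c b. i \<in> cof (op_model C) \<inter> weq (op_model C)
          \<and> p \<in> fib (op_model C) \<and> f = p \<cdot>\<^bsub>op_model C\<^esub> i"
        \<comment> \<open>The two factorizations trade places: an acyclic cofibration followed by a
          fibration in the opposite category is, read in \<open>C\<close>, a cofibration followed by
          an acyclic fibration.\<close>
        using CM5_acyclic_fib[OF *] by auto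
      show "\<exists>c. \<exists>i\<in>hom (op_model C) a c. \<exists>p\<in>hom (op_model C) c b. i \<in> cof (op_model C)
          \<and> p \<in> fib (op_model C) \<inter> weq (op_model C) \<and> f = p \<cdot>\<^bsub>op_model C\<^esub> i"
        using CM5_acyclic_cof[OF *] by auto }
  qed (use weq_Mor cof_Mor fib_Mor CM1_limits CM1_colimits
       in \<open>auto intro: has_finite_limits_op has_finite_colimits_op CM2_comp CM2_left CM2_right
         CM3_weq CM3_cof CM3_fib CM4_acyclic_cof CM4_acyclic_fib has_lifting_op dest!: retract_of_op\<close>)
qed

section \<open>Cofibrations and lifting\<close>

context closed_model_category
begin

text \<open>The retract argument: \<open>h\<close> is a diagonal of the square from
  \<open>p \<cdot> j\<close> to \<open>p\<close> with \<open>j\<close> on top and an identity below.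
  The retraction is the identity on domains and \<open>p\<close> on codomains.\<close>

lemma retract_of_factor:
  assumes j: "j \<in> hom C a c" and p: "p \<in> hom C c b" and h: "h \<in> hom C b c"
    and "h \<cdot> (p \<cdot> j) = j" "p \<cdot> h = Id C b"
  shows "retract_of C (p \<cdot> j) j"
proof -
  have a: "a \<in> Obj C" using j Dom_Obj by (auto simp: hom_def)
  have pj: "p \<cdot> j \<in> hom C a b" using Comp_hom j p by blast
  show ?thesis
    unfolding retract_of_def
    by (rule exI[of _ a], rule exI[of _ b], rule exI[of _ a], rule exI[of _ c],
        rule bexI[of _ "Id C a"], rule bexI[of _ "Id C a"], rule bexI[of _ h], rule bexI[of _ p])
      (simp_all add: assms pj Id_hom[OF a] Comp_Id[OF j] Comp_Id[OF pj] Comp_Id[OF Id_hom[OF a]])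
qed

text \<open>Factor \<open>i\<close> as a cofibration \<open>j\<close> followed by an acyclic
  fibration \<open>p\<close>. Lifting \<open>i\<close> against \<open>p\<close> makes
  \<open>i\<close> a retract of \<open>j\<close>.\<close>

lemma cof_if_lifting:
  assumes i: "i \<in> Mor C" and lift: "\<And>p. p \<in> fib C \<inter> weq C \<Longrightarrow> has_lifting C i p"
  shows "i \<in> cof C"
proof -
  let ?a = "Dom C i" and ?b = "Cod C i"
  have ih: "i \<in> hom C ?a ?b" using i by (simp add: hom_def)
  obtain c j p where jp: "j \<in> hom C ?a c" "p \<in> hom C c ?b" "j \<in> cof C" "p \<in> fib C \<inter> weq C" "i = p \<cdot> j"
    using CM5_acyclic_fib[OF ih] by blast
  have D: "Dom C p = c" "Cod C p = ?b" using jp by (auto simp: hom_def)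
  have ob: "?a \<in> Obj C" "?b \<in> Obj C" using i Dom_Obj Cod_Obj by auto
  have "p \<cdot> j = Id C ?b \<cdot> i" using jp Id_Comp[OF ih] by simp
  then obtain h where h: "h \<in> hom C ?b c" "h \<cdot> i = j" "p \<cdot> h = Id C ?b"
    using lift[OF jp(4)] jp(1) Id_hom[OF ob(2)] unfolding has_lifting_def D by blast
  have "retract_of C i j" using retract_of_factor[OF jp(1,2) h(1)] h jp(5) by simp
  then show ?thesis using CM3_cof jp by blast
qed

text \<open>The same argument with the other factorization; the retract inherits both properties of
  \<open>j\<close>.\<close>

lemma acyclic_cof_if_lifting:
  assumes i: "i \<in> Mor C" and lift: "\<And>p. p \<in> fib C \<Longrightarrow> has_lifting C i p"
  shows "i \<in> cof C \<inter> weq C"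
proof -
  let ?a = "Dom C i" and ?b = "Cod C i"
  have ih: "i \<in> hom C ?a ?b" using i by (simp add: hom_def)
  obtain c j p where jp: "j \<in> hom C ?a c" "p \<in> hom C c ?b" "j \<in> cof C \<inter> weq C" "p \<in> fib C" "i = p \<cdot> j"
    using CM5_acyclic_cof[OF ih] by blast
  have D: "Dom C p = c" "Cod C p = ?b" using jp by (auto simp: hom_def)
  have ob: "?a \<in> Obj C" "?b \<in> Obj C" using i Dom_Obj Cod_Obj by auto
  have "p \<cdot> j = Id C ?b \<cdot> i" using jp Id_Comp[OF ih] by simp
  then obtain h where h: "h \<in> hom C ?b c" "h \<cdot> i = j" "p \<cdot> h = Id C ?b"
    using lift[OF jp(4)] jp(1) Id_hom[OF ob(2)] unfolding has_lifting_def D by blast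
  have "retract_of C i j" using retract_of_factor[OF jp(1,2) h(1)] h jp(5) by simp
  then show ?thesis using CM3_cof CM3_weq jp by blast
qed

text \<open>Obtained from the lifting criterion: lift first along \<open>f\<close>, then along
  \<open>g\<close> with the first diagonal as the new top map.\<close>

lemma cof_comp:
  assumes f: "f \<in> hom C a b" "f \<in> cof C" and g: "g \<in> hom C b c" "g \<in> cof C"
  shows "g \<cdot> f \<in> cof C"
proof (rule cof_if_lifting)
  have gf: "g \<cdot> f \<in> hom C a c" using Comp_hom f g by blast
  then show "g \<cdot> f \<in> Mor C" by (simp add: hom_def)
  fix p assume p: "p \<in> fib C \<inter> weq C"
  have ph: "p \<in> hom C (Dom C p) (Cod C p)" using p fib_Mor by (auto simp: hom_def)
  have D: "Dom C (g \<cdot> f) = a" "Cod C (g \<cdot> f) = c" "Dom C f = a" "Cod C f = b" "Dom C g = b" "Cod C g = c"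
    using gf f g by (auto simp: hom_def)
  show "has_lifting C (g \<cdot> f) p"
    unfolding has_lifting_def D
  proof (intro ballI impI)
    fix u v assume u: "u \<in> hom C a (Dom C p)" and v: "v \<in> hom C c (Cod C p)" and e: "p \<cdot> u = v \<cdot> (g \<cdot> f)"
    have "p \<cdot> u = (v \<cdot> g) \<cdot> f" using e Comp_assoc f g v by metis
    then obtain h where h: "h \<in> hom C b (Dom C p)" "h \<cdot> f = u" "p \<cdot> h = v \<cdot> g"
      using CM4_acyclic_fib[OF f(2) p] u Comp_hom[OF g(1) v] unfolding has_lifting_def D by blast
    then obtain k where k: "k \<in> hom C c (Dom C p)" "k \<cdot> g = h" "p \<cdot> k = v"
      using CM4_acyclic_fib[OF g(2) p] v unfolding has_lifting_def D by blast
    then have "k \<cdot> (g \<cdot> f) = u" using Comp_assoc[OF f(1) g(1)] h by simp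
    then show "\<exists>h\<in>hom C c (Dom C p). h \<cdot> (g \<cdot> f) = u \<and> p \<cdot> h = v" using k by blast
  qed
qed

text \<open>The definition asks only for some initial object; this frees it from the choice. The
  comparison maps between two initial objects exhibit \<open>f\<close> as a retract of the given
  cofibration \<open>f'\<close>.\<close>

lemma cofibrant_iff:
  assumes i: "initial_object C i" and f: "f \<in> hom C i a"
  shows "cofibrant C a \<longleftrightarrow> f \<in> cof C"
proof
  have a: "a \<in> Obj C" using f Cod_Obj by (auto simp: hom_def)
  show "f \<in> cof C \<Longrightarrow> cofibrant C a" unfolding cofibrant_def using i f a by blast
  assume "cofibrant C a"
  then obtain i' f' where i': "initial_object C i'" and f': "f' \<in> hom C i' a" "f' \<in> cof C"
    unfolding cofibrant_def by blast
  note I = i[unfolded initial_object_def] and I' = i'[unfolded initial_object_def]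
  obtain s where s: "s \<in> hom C i i'" using I I' by blast
  obtain r where r: "r \<in> hom C i' i" using I I' by blast
  have "r \<cdot> s \<in> hom C i i" "f' \<cdot> s \<in> hom C i a" "f \<cdot> r \<in> hom C i' a" using Comp_hom r s f f'(1) by blast+
  then have e: "r \<cdot> s = Id C i" "f' \<cdot> s = f" "f \<cdot> r = f'" using I I' Id_hom f f'(1) a by blast+
  have "retract_of C f f'"
    unfolding retract_of_def
    by (rule exI[of _ i], rule exI[of _ a], rule exI[of _ i'], rule exI[of _ a],
        rule bexI[of _ s], rule bexI[of _ r], rule bexI[of _ "Id C a"], rule bexI[of _ "Id C a"])
      (simp_all add: s r f f'(1) e Id_hom[OF a] Id_Comp[OF Id_hom[OF a]] Id_Comp[OF f] Id_Comp[OF f'(1)])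
  then show "f \<in> cof C" using CM3_cof f' by blast
qed

lemma cofibrant_Cod:
  assumes "cofibrant C a" and f: "f \<in> hom C a b" "f \<in> cof C"
  shows "cofibrant C b"
proof -
  obtain i h where h: "initial_object C i" "h \<in> hom C i a" "h \<in> cof C"
    using assms unfolding cofibrant_def by blast
  then show ?thesis
    using cofibrant_iff[OF h(1) Comp_hom[OF h(2) f(1)]] cof_comp[OF h(2,3) f] by simp
qed

lemma terminal_object_exists: "\<exists>t. terminal_object C t"
proof -
  let ?J = "\<lparr>Obj = {}, Mor = {}, Dom = id, Cod = id, Id = id, Comp = \<lambda>a b. a\<rparr> :: (nat, nat) cat"
  have "category ?J" by unfold_locales (auto simp: hom_def)
  then have "is_functor ?J C F" for F
    unfolding is_functor_def using category_axioms by (simp add: hom_def)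
  \<comment> \<open>Every \<open>F\<close> is a functor on the empty category, so
    \<open>undefined\<close> can serve as the diagram. A limit of the empty diagram is a terminal
    object.\<close>
  then obtain t p where "limit_cone ?J C undefined t p"
    using CM1_limits unfolding has_finite_limits_def by fastforce
  then show ?thesis
    unfolding limit_cone_def cone_def terminal_object_def by (intro exI[of _ t]) (simp add: hom_def)
qed

end

lemma fibrant_iff:
  assumes "closed_model_category C" "terminal_object C t" "f \<in> hom C a t"
  shows "fibrant C a \<longleftrightarrow> f \<in> fib C"
  using closed_model_category.cofibrant_iff[OF closed_model_category_op[OF assms(1)], of t f a] assms
  by simp

section \<open>Adjunctions\<close>

lemma adjunctionD:
  assumes "adjunction C D A"
  shows "is_functor C D (left A)" "is_functor D C (right A)"
    "a \<in> Obj C \<Longrightarrow> unit A a \<in> hom C a (ob (right A) (ob (left A) a))"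
    "f \<in> hom C a a' \<Longrightarrow> mor (right A) (mor (left A) f) \<cdot>\<^bsub>C\<^esub> unit A a = unit A a' \<cdot>\<^bsub>C\<^esub> f"
    "b \<in> Obj D \<Longrightarrow> counit A b \<in> hom D (ob (left A) (ob (right A) b)) b"
    "g \<in> hom D b b' \<Longrightarrow> g \<cdot>\<^bsub>D\<^esub> counit A b = counit A b' \<cdot>\<^bsub>D\<^esub> mor (left A) (mor (right A) g)"
    "a \<in> Obj C \<Longrightarrow> counit A (ob (left A) a) \<cdot>\<^bsub>D\<^esub> mor (left A) (unit A a) = Id D (ob (left A) a)"
    "b \<in> Obj D \<Longrightarrow> mor (right A) (counit A b) \<cdot>\<^bsub>C\<^esub> unit A (ob (right A) b) = Id C (ob (right A) b)"
  using assms unfolding adjunction_def by blast+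

lemma is_functorD:
  assumes "is_functor C D F"
  shows "category C" "category D" "a \<in> Obj C \<Longrightarrow> ob F a \<in> Obj D"
    "f \<in> hom C a b \<Longrightarrow> mor F f \<in> hom D (ob F a) (ob F b)"
    "a \<in> Obj C \<Longrightarrow> mor F (Id C a) = Id D (ob F a)"
    "f \<in> hom C a b \<Longrightarrow> g \<in> hom C b c \<Longrightarrow> mor F (g \<cdot>\<^bsub>C\<^esub> f) = mor F g \<cdot>\<^bsub>D\<^esub> mor F f"
  using assms unfolding is_functor_def by blast+

lemma adjunction_op: "adjunction C D A \<Longrightarrow> adjunction (op_model D) (op_model C) (op_adj A)"
  unfolding adjunction_def is_functor_op by simp

context
  fixes C :: "('o1, 'm1, 'y) cat_scheme" and D :: "('o2, 'm2, 'z) cat_scheme" and A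
  assumes adj: "adjunction C D A"
begin

lemma adjunct_hom:
  assumes "f \<in> hom D (ob (left A) a) b" "a \<in> Obj C"
  shows "mor (right A) f \<cdot>\<^bsub>C\<^esub> unit A a \<in> hom C a (ob (right A) b)"
  using category.Comp_hom is_functorD adjunctionD[OF adj] assms by meson

lemma adjunct_hom':
  assumes "f \<in> hom C a (ob (right A) b)" "b \<in> Obj D"
  shows "counit A b \<cdot>\<^bsub>D\<^esub> mor (left A) f \<in> hom D (ob (left A) a) b"
  using category.Comp_hom is_functorD adjunctionD[OF adj] assms by meson

text \<open>Naturality of the unit moves \<open>f\<close> past it, and the triangle identity at
  \<open>b\<close> removes what is left.\<close>

lemma adjunct_left_inverse:
  assumes f: "f \<in> hom C a (ob (right A) b)" and b: "b \<in> Obj D"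
  shows "mor (right A) (counit A b \<cdot>\<^bsub>D\<^esub> mor (left A) f) \<cdot>\<^bsub>C\<^esub> unit A a = f"
proof -
  note F = adjunctionD[OF adj] and L = is_functorD[OF adjunctionD(1)[OF adj]]
    and R = is_functorD[OF adjunctionD(2)[OF adj]]
  interpret C: category C by (rule L)
  have a: "a \<in> Obj C" using f C.hom_ObjD by blast
  have "mor (right A) (counit A b \<cdot>\<^bsub>D\<^esub> mor (left A) f) \<cdot>\<^bsub>C\<^esub> unit A a
    = (mor (right A) (counit A b) \<cdot>\<^bsub>C\<^esub> mor (right A) (mor (left A) f)) \<cdot>\<^bsub>C\<^esub> unit A a"
    using R(6)[OF L(4)[OF f] F(5)[OF b]] by simp
  also have "\<dots> = mor (right A) (counit A b) \<cdot>\<^bsub>C\<^esub> (unit A (ob (right A) b) \<cdot>\<^bsub>C\<^esub> f)"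
    using C.Comp_assoc[OF F(3)[OF a] R(4)[OF L(4)[OF f]] R(4)[OF F(5)[OF b]]] F(4)[OF f] by simp
  also have "\<dots> = f"
    using C.Comp_assoc[OF f F(3)[OF R(3)[OF b]] R(4)[OF F(5)[OF b]]] F(8)[OF b] C.Id_Comp[OF f] by simp
  finally show ?thesis .
qed

end

text \<open>The mirror computation: naturality of the counit, then the triangle identity at
  \<open>a\<close>.\<close>

lemma adjunct_right_inverse:
  assumes adj: "adjunction C D A" and f: "f \<in> hom D (ob (left A) a) b" and a: "a \<in> Obj C"
  shows "counit A b \<cdot>\<^bsub>D\<^esub> mor (left A) (mor (right A) f \<cdot>\<^bsub>C\<^esub> unit A a) = f"
proof -
  note F = adjunctionD[OF adj] and L = is_functorD[OF adjunctionD(1)[OF adj]]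
    and R = is_functorD[OF adjunctionD(2)[OF adj]]
  interpret D: category D by (rule R)
  have b: "b \<in> Obj D" using f D.hom_ObjD by blast
  have "counit A b \<cdot>\<^bsub>D\<^esub> mor (left A) (mor (right A) f \<cdot>\<^bsub>C\<^esub> unit A a)
    = counit A b \<cdot>\<^bsub>D\<^esub> (mor (left A) (mor (right A) f) \<cdot>\<^bsub>D\<^esub> mor (left A) (unit A a))"
    using L(6)[OF F(3)[OF a] R(4)[OF f]] by simp
  also have "\<dots> = (f \<cdot>\<^bsub>D\<^esub> counit A (ob (left A) a)) \<cdot>\<^bsub>D\<^esub> mor (left A) (unit A a)"
    using D.Comp_assoc[OF L(4)[OF F(3)[OF a]] L(4)[OF R(4)[OF f]] F(5)[OF b]] F(6)[OF f] by simp
  also have "\<dots> = f"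
    using D.Comp_assoc[OF L(4)[OF F(3)[OF a]] F(5)[OF L(3)[OF a]] f] F(7)[OF a] D.Comp_Id[OF f] by simp
  finally show ?thesis .
qed

text \<open>Transpose the square from \<open>mor (left A) i\<close> to \<open>p\<close> into one
  from \<open>i\<close> to \<open>mor (right A) p\<close>, lift there, and transpose the diagonal
  back.\<close>

lemma has_lifting_adjunct:
  assumes adj: "adjunction C D A" and i: "i \<in> hom C a b" and p: "p \<in> hom D c d"
    and lift: "has_lifting C i (mor (right A) p)"
  shows "has_lifting D (mor (left A) i) p"
proof -
  note F = adjunctionD[OF adj] and L = is_functorD[OF adjunctionD(1)[OF adj]]
    and R = is_functorD[OF adjunctionD(2)[OF adj]]
  interpret C: category C by (rule L)
  interpret D: category D by (rule R)
  have ab: "a \<in> Obj C" "b \<in> Obj C" and cd: "c \<in> Obj D" "d \<in> Obj D"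
    using i p C.hom_ObjD D.hom_ObjD by blast+
  have Li: "mor (left A) i \<in> hom D (ob (left A) a) (ob (left A) b)" using L(4)[OF i] .
  have Rp: "mor (right A) p \<in> hom C (ob (right A) c) (ob (right A) d)" using R(4)[OF p] .
  have dc: "Dom D (mor (left A) i) = ob (left A) a" "Cod D (mor (left A) i) = ob (left A) b"
    "Dom D p = c" "Cod D p = d" "Dom C i = a" "Cod C i = b"
    "Dom C (mor (right A) p) = ob (right A) c" "Cod C (mor (right A) p) = ob (right A) d"
    using Li Rp i p by (auto simp: hom_def)
  show ?thesis
    unfolding has_lifting_def dc
  proof (intro ballI impI)
    fix u v
    assume u: "u \<in> hom D (ob (left A) a) c" and v: "v \<in> hom D (ob (left A) b) d"
      and e: "p \<cdot>\<^bsub>D\<^esub> u = v \<cdot>\<^bsub>D\<^esub> mor (left A) i"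
    let ?u = "mor (right A) u \<cdot>\<^bsub>C\<^esub> unit A a" and ?v = "mor (right A) v \<cdot>\<^bsub>C\<^esub> unit A b"
    have u': "?u \<in> hom C a (ob (right A) c)" and v': "?v \<in> hom C b (ob (right A) d)"
      using adjunct_hom[OF adj] u v ab by blast+
    have "mor (right A) p \<cdot>\<^bsub>C\<^esub> ?u = mor (right A) (p \<cdot>\<^bsub>D\<^esub> u) \<cdot>\<^bsub>C\<^esub> unit A a"
      using C.Comp_assoc[OF F(3)[OF ab(1)] R(4)[OF u] Rp] R(6)[OF u p] by simp
    also have "\<dots> = mor (right A) v \<cdot>\<^bsub>C\<^esub> (mor (right A) (mor (left A) i) \<cdot>\<^bsub>C\<^esub> unit A a)"
      using C.Comp_assoc[OF F(3)[OF ab(1)] R(4)[OF Li] R(4)[OF v]] R(6)[OF Li v] e by simp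
    also have "\<dots> = ?v \<cdot>\<^bsub>C\<^esub> i"
      using C.Comp_assoc[OF i F(3)[OF ab(2)] R(4)[OF v]] F(4)[OF i] by simp
    finally obtain h where h: "h \<in> hom C b (ob (right A) c)" "h \<cdot>\<^bsub>C\<^esub> i = ?u" "mor (right A) p \<cdot>\<^bsub>C\<^esub> h = ?v"
      using lift u' v' unfolding has_lifting_def dc by blast
    let ?h = "counit A c \<cdot>\<^bsub>D\<^esub> mor (left A) h"
    have "?h \<cdot>\<^bsub>D\<^esub> mor (left A) i = u"
      using D.Comp_assoc[OF Li L(4)[OF h(1)] F(5)[OF cd(1)]] L(6)[OF i h(1)] h(2)
        adjunct_right_inverse[OF adj u ab(1)] by simp
    moreover have "p \<cdot>\<^bsub>D\<^esub> ?h = v"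
      using D.Comp_assoc[OF L(4)[OF h(1)] F(5)[OF cd(1)] p] F(6)[OF p] L(6)[OF h(1) Rp] h(3)
        D.Comp_assoc[OF L(4)[OF h(1)] L(4)[OF Rp] F(5)[OF cd(2)]]
        adjunct_right_inverse[OF adj v ab(2)] by simp
    ultimately show "\<exists>h\<in>hom D (ob (left A) b) c. h \<cdot>\<^bsub>D\<^esub> mor (left A) i = u \<and> p \<cdot>\<^bsub>D\<^esub> h = v"
      using adjunct_hom'[OF adj h(1) cd(1)] by blast
  qed
qed

text \<open>Lifting a left-transported cofibration against \<open>p\<close> amounts to lifting the
  cofibration against \<open>mor (right A) p\<close>, which CM4 provides; the lifting criteria then
  recognise the image.\<close>

lemma quillen_adjunctionI_right:
  assumes C: "closed_model_category C" and D: "closed_model_category D" and adj: "adjunction C D A"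
    and fib: "\<And>f. f \<in> fib D \<Longrightarrow> mor (right A) f \<in> fib C"
    and afib: "\<And>f. f \<in> fib D \<Longrightarrow> f \<in> weq D \<Longrightarrow> mor (right A) f \<in> weq C"
  shows "quillen_adjunction C D A"
proof -
  interpret C: closed_model_category C by fact
  interpret D: closed_model_category D by fact
  have Mor: "mor (left A) f \<in> Mor D" if "f \<in> cof C" for f
    using is_functorD(4)[OF adjunctionD(1)[OF adj]] that C.cof_Mor unfolding hom_def by blast
  have lift: "has_lifting D (mor (left A) f) p"
    if "f \<in> cof C" "p \<in> fib D" "has_lifting C f (mor (right A) p)" for f p
    using has_lifting_adjunct[OF adj _ _ that(3)] that(1,2) C.cof_Mor D.fib_Mor unfolding hom_def by blast
  show ?thesis
    unfolding quillen_adjunction_def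
    using C D adj
    by (intro conjI ballI D.cof_if_lifting D.acyclic_cof_if_lifting)
      (auto intro: Mor fib afib lift[OF _ _ C.CM4_acyclic_cof] lift[OF _ _ C.CM4_acyclic_fib])
qed

text \<open>The right adjoint of \<open>op_adj A\<close> is the original left adjoint, and
  fibrations of the opposite are cofibrations, so the assumptions are those of the criterion for
  right adjoints.\<close>

lemma quillen_adjunction_op:
  assumes "quillen_adjunction C D A"
  shows "quillen_adjunction (op_model D) (op_model C) (op_adj A)"
  using assms unfolding quillen_adjunction_def[of C D A]
  by (intro quillen_adjunctionI_right) (auto intro: closed_model_category_op adjunction_op)

lemma quillen_equivalence_op:
  assumes qe: "quillen_equivalence C D A"
  shows "quillen_equivalence (op_model D) (op_model C) (op_adj A)"
proof -
  have qa: "quillen_adjunction C D A" and adj: "adjunction C D A"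
    using qe unfolding quillen_equivalence_def quillen_adjunction_def by blast+
  have "f \<in> weq C \<longleftrightarrow> counit A x \<cdot>\<^bsub>D\<^esub> mor (left A) f \<in> weq D"
    if xy: "fibrant D x" "cofibrant C y" and f: "f \<in> hom C y (ob (right A) x)" for x y f
  proof -
    have x: "x \<in> Obj D" using xy unfolding fibrant_def by blast
    show ?thesis
      \<comment> \<open>The equivalence condition is applied to the transpose of \<open>f\<close>,
        whose own transpose is \<open>f\<close> again.\<close>
      using qe adjunct_hom'[OF adj f x] xy adjunct_left_inverse[OF adj f x]
      unfolding quillen_equivalence_def by metis
  qed
  then show ?thesis
    unfolding quillen_equivalence_def using quillen_adjunction_op[OF qa] by simp blast
qed

section \<open>Adjoining an initial object to an index category\<close>

text \<open>The object \<open>0\<close> is the new initial object and \<open>Suc j\<close> the old object \<open>j\<close>. The morphism \<open>0\<close> is the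
  identity of \<open>0\<close>, \<open>2 j + 1\<close> the morphism \<open>0 \<rightarrow> Suc j\<close>, and \<open>2 s + 2\<close> the old morphism \<open>s\<close>.\<close>

definition adjoin_initial :: "(nat, nat) cat \<Rightarrow> (nat, nat) cat" where
  "adjoin_initial J =
     \<lparr> Obj = insert 0 (Suc ` Obj J),
       Mor = insert 0 ((\<lambda>j. Suc (2 * j)) ` Obj J \<union> (\<lambda>s. Suc (Suc (2 * s))) ` Mor J),
       Dom = (\<lambda>m. if m \<noteq> 0 \<and> even m then Suc (Dom J (m div 2 - 1)) else 0),
       Cod = (\<lambda>m. if m = 0 then 0 else if even m then Suc (Cod J (m div 2 - 1)) else Suc (m div 2)),
       Id = (\<lambda>a. if a = 0 then 0 else Suc (Suc (2 * Id J (a - 1)))),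
       Comp = (\<lambda>n m. if m = 0 then n
                else if even m then Suc (Suc (2 * ((n div 2 - 1) \<cdot>\<^bsub>J\<^esub> (m div 2 - 1))))
                else Suc (2 * Cod J (n div 2 - 1))) \<rparr>"

lemma adjoin_initial_simps [simp]:
  "Obj (adjoin_initial J) = insert 0 (Suc ` Obj J)"
  "Id (adjoin_initial J) 0 = 0"
  "Id (adjoin_initial J) (Suc a) = Suc (Suc (2 * Id J a))"
  "n \<cdot>\<^bsub>adjoin_initial J\<^esub> 0 = n"
  "Suc (Suc (2 * s)) \<cdot>\<^bsub>adjoin_initial J\<^esub> Suc (2 * j) = Suc (2 * Cod J s)"
  "Suc (Suc (2 * s)) \<cdot>\<^bsub>adjoin_initial J\<^esub> Suc (Suc (2 * t)) = Suc (Suc (2 * (s \<cdot>\<^bsub>J\<^esub> t)))"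
  by (simp_all add: adjoin_initial_def)

text \<open>Splits morphisms into the identity of \<open>0\<close>, the new maps out of
  \<open>0\<close> and the old maps, so that later proofs argue by cases rather than by
  parity.\<close>

lemma hom_adjoin_initial:
  "m \<in> hom (adjoin_initial J) a b \<longleftrightarrow>
     a = 0 \<and> b = 0 \<and> m = 0 \<or>
     (\<exists>j\<in>Obj J. a = 0 \<and> b = Suc j \<and> m = Suc (2 * j)) \<or>
     (\<exists>j k. \<exists>s\<in>hom J j k. a = Suc j \<and> b = Suc k \<and> m = Suc (Suc (2 * s)))"
  by (auto simp: adjoin_initial_def hom_def)

lemma category_adjoin_initial:
  assumes "category J"
  shows "category (adjoin_initial J)"
proof -
  interpret J: category J by fact
  let ?J = "adjoin_initial J"
  show ?thesis
  proof
    fix f assume "f \<in> Mor ?J"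
    then show "Dom ?J f \<in> Obj ?J" "Cod ?J f \<in> Obj ?J"
      by (auto simp: adjoin_initial_def J.Dom_Obj J.Cod_Obj)
  next
    fix a b c d f g h
    show "a \<in> Obj ?J \<Longrightarrow> Id ?J a \<in> hom ?J a a"
      using J.Id_hom by (auto simp: hom_adjoin_initial)
    assume f: "f \<in> hom ?J a b"
    show "f \<cdot>\<^bsub>?J\<^esub> Id ?J a = f"
      using f by (auto simp: hom_adjoin_initial J.Comp_Id)
    show "Id ?J b \<cdot>\<^bsub>?J\<^esub> f = f"
      using f J.Id_hom by (auto simp: hom_adjoin_initial J.Id_Comp dest: J.hom_ObjD) (simp add: hom_def)
    assume g: "g \<in> hom ?J b c"
    show "g \<cdot>\<^bsub>?J\<^esub> f \<in> hom ?J a c"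
      using f g J.Comp_hom J.hom_ObjD unfolding hom_adjoin_initial by (fastforce simp: hom_def)
    assume h: "h \<in> hom ?J c d"
    show "h \<cdot>\<^bsub>?J\<^esub> (g \<cdot>\<^bsub>?J\<^esub> f) = (h \<cdot>\<^bsub>?J\<^esub> g) \<cdot>\<^bsub>?J\<^esub> f"
      using f g h J.Comp_hom J.Comp_assoc unfolding hom_adjoin_initial by (fastforce simp: hom_def)
  qed
qed

section \<open>Coslices of model categories\<close>

text \<open>The underlying map is the middle component, which makes it independent of the
  orientation of the triple.\<close>

abbreviation und :: "'m \<times> 'm \<times> 'm \<Rightarrow> 'm" where
  "und m \<equiv> fst (snd m)"

text \<open>A morphism \<open>\<alpha>\<close> from \<open>a\<close> to \<open>b\<close> is encoded as \<open>mk a \<alpha> b\<close>. The orientation of the triples is left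
  open because the opposite of a slice of \<open>C\<close> is a coslice of the opposite of \<open>C\<close> only up to swapping
  their outer components.\<close>

locale coslice_like = closed_model_category C
  for C :: "('o, 'm, 'z) model_cat_scheme"  (structure) +
  fixes X :: 'o and E :: "('m, 'm \<times> 'm \<times> 'm) model_cat" and mk :: "'m \<Rightarrow> 'm \<Rightarrow> 'm \<Rightarrow> 'm \<times> 'm \<times> 'm"
  assumes X: "X \<in> Obj C"
    and Obj_E: "Obj E = {f \<in> Mor C. Dom C f = X}"
    and Mor_E: "Mor E = {mk a \<alpha> b | a \<alpha> b. a \<in> Obj E \<and> b \<in> Obj E \<and>
      \<alpha> \<in> hom C (Cod C a) (Cod C b) \<and> b = \<alpha> \<cdot> a}"
    and Dom_mk [simp]: "Dom E (mk a \<alpha> b) = a"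
    and Cod_mk [simp]: "Cod E (mk a \<alpha> b) = b"
    and und_mk [simp]: "und (mk a \<alpha> b) = \<alpha>"
    and Id_E: "Id E a = mk a (Id C (Cod C a)) a"
    and Comp_E [simp]: "mk b' \<beta> c \<cdot>\<^bsub>E\<^esub> mk a \<alpha> b = mk a (\<beta> \<cdot> \<alpha>) c"
    and weq_E: "weq E = {m \<in> Mor E. und m \<in> weq C}"
    and cof_E: "cof E = {m \<in> Mor E. und m \<in> cof C}"
    and fib_E: "fib E = {m \<in> Mor E. und m \<in> fib C}"
begin

section \<open>The coslice category and its faithful functor to \<open>C\<close>\<close>

lemma Obj_E_iff: "a \<in> Obj E \<longleftrightarrow> a \<in> hom C X (Cod C a)"
  by (auto simp: Obj_E hom_def)

lemma Obj_EI: "a \<in> hom C X c \<Longrightarrow> a \<in> Obj E"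
  by (auto simp: Obj_E hom_def)

lemma hom_E_iff:
  "m \<in> hom E a b \<longleftrightarrow> (\<exists>c d \<alpha>. a \<in> hom C X c \<and> b \<in> hom C X d \<and> \<alpha> \<in> hom C c d \<and> \<alpha> \<cdot> a = b \<and> m = mk a \<alpha> b)"
  by (auto simp: hom_def Mor_E Obj_E)

lemma mk_hom: "a \<in> hom C X c \<Longrightarrow> \<alpha> \<in> hom C c d \<Longrightarrow> \<alpha> \<cdot> a = b \<Longrightarrow> mk a \<alpha> b \<in> hom E a b"
  unfolding hom_E_iff using Comp_hom by blast

lemma hom_ED:
  assumes "m \<in> hom E a b"
  shows "a \<in> hom C X (Cod C a)" "b \<in> hom C X (Cod C b)" "und m \<in> hom C (Cod C a) (Cod C b)"
    "und m \<cdot> a = b" "m = mk a (und m) b"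
  using assms unfolding hom_E_iff by (auto simp: hom_def)

lemma mk_in_model:
  assumes "mk a \<alpha> b \<in> hom E a b"
  shows "mk a \<alpha> b \<in> weq E \<longleftrightarrow> \<alpha> \<in> weq C" "mk a \<alpha> b \<in> cof E \<longleftrightarrow> \<alpha> \<in> cof C"
    "mk a \<alpha> b \<in> fib E \<longleftrightarrow> \<alpha> \<in> fib C"
  using assms by (auto simp: weq_E cof_E fib_E hom_def)

text \<open>The functor to \<open>C\<close> is faithful; together with \<open>und_Comp\<close> this
  reduces equations between parallel morphisms to equations in \<open>C\<close>.\<close>

lemma eqI_E: "m \<in> hom E a b \<Longrightarrow> n \<in> hom E a b \<Longrightarrow> und m = und n \<Longrightarrow> m = n"
  using hom_ED(5) by metis

lemma und_Comp: "m \<in> hom E a b \<Longrightarrow> n \<in> hom E b c \<Longrightarrow> und (n \<cdot>\<^bsub>E\<^esub> m) = und n \<cdot> und m"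
  using hom_ED(5) Comp_E und_mk by metis

lemma category_E: "category E"
proof
  fix f assume "f \<in> Mor E"
  then show "Dom E f \<in> Obj E" "Cod E f \<in> Obj E" by (auto simp: Mor_E)
next
  fix a assume "a \<in> Obj E"
  then show "Id E a \<in> hom E a a"
    unfolding Obj_E_iff Id_E using mk_hom Id_hom Id_Comp hom_ObjD by blast
next
  fix a b f assume "f \<in> hom E a b"
  note f = hom_ED[OF this]
  show "f \<cdot>\<^bsub>E\<^esub> Id E a = f" "Id E b \<cdot>\<^bsub>E\<^esub> f = f"
    using f(5) Comp_Id[OF f(3)] Id_Comp[OF f(3)] Comp_E Id_E by metis+
next
  fix a b c f g assume f: "f \<in> hom E a b" and g: "g \<in> hom E b c"
  note * = hom_ED[OF f] and ** = hom_ED[OF g]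
  have "(und g \<cdot> und f) \<cdot> a = c" using Comp_assoc[OF *(1,3) **(3)] *(4) **(4) by simp
  then show "g \<cdot>\<^bsub>E\<^esub> f \<in> hom E a c"
    using mk_hom[OF *(1) Comp_hom[OF *(3) **(3)]] *(5) **(5) Comp_E by metis
next
  fix a b c d f g h assume "f \<in> hom E a b" "g \<in> hom E b c" "h \<in> hom E c d"
  note * = hom_ED(3,5)[OF this(1)] hom_ED(3,5)[OF this(2)] hom_ED(3,5)[OF this(3)]
  show "h \<cdot>\<^bsub>E\<^esub> (g \<cdot>\<^bsub>E\<^esub> f) = (h \<cdot>\<^bsub>E\<^esub> g) \<cdot>\<^bsub>E\<^esub> f"
    by (subst (1 2) *(2), subst (1 2) *(4), subst (1 2) *(6)) (simp add: Comp_assoc[OF *(1,3,5)])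
qed

section \<open>Initial object, finite limits and finite colimits of the coslice\<close>

lemma initial_object_Id: "initial_object E (Id C X)"
proof -
  have 1: "Id C X \<in> hom C X X" using Id_hom[OF X] .
  show ?thesis
    unfolding initial_object_def
  proof (intro conjI ballI)
    show "Id C X \<in> Obj E" using Obj_EI[OF 1] .
    fix a assume "a \<in> Obj E"
    then have a: "a \<in> hom C X (Cod C a)" by (simp add: Obj_E_iff)
    show "\<exists>!f. f \<in> hom E (Id C X) a"
    proof
      show "mk (Id C X) a a \<in> hom E (Id C X) a" using mk_hom[OF 1 a Comp_Id[OF a]] .
      have "Cod C (Id C X) = X" using 1 by (simp add: hom_def)
      then show "f = mk (Id C X) a a" if "f \<in> hom E (Id C X) a" for f
        using hom_ED(3-5)[OF that] Comp_Id by metis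
    qed
  qed
qed

text \<open>The functor to \<open>C\<close> creates limits: the structure maps of the diagram form a
  cone with apex \<open>X\<close>, and the induced map \<open>x\<close> into the limit taken in
  \<open>C\<close> is the structure map of the limit in the coslice.\<close>

lemma has_finite_limits_E: "has_finite_limits E"
  unfolding has_finite_limits_def
proof (intro allI impI)
  fix J :: "(nat, nat) cat" and F
  assume J: "finite (Obj J) \<and> finite (Mor J) \<and> is_functor J E F"
  then have F: "is_functor J E F" by simp
  note FD = is_functorD[OF F]
  interpret J: category J by (rule FD)
  interpret E: category E by (rule category_E)
  let ?F = "\<lparr>ob = \<lambda>j. Cod C (ob F j), mor = \<lambda>s. und (mor F s)\<rparr>"
  have obj: "ob F j \<in> hom C X (Cod C (ob F j))" if "j \<in> Obj J" for j
    using FD(3)[OF that] by (simp add: Obj_E_iff)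
  have "is_functor J C ?F"
    unfolding is_functor_def
  proof (intro conjI ballI allI)
    fix a b c s t
    show "a \<in> Obj J \<Longrightarrow> ob ?F a \<in> Obj C"
      using obj hom_ObjD by simp blast
    show "a \<in> Obj J \<Longrightarrow> mor ?F (Id J a) = Id C (ob ?F a)"
      using FD(5) by (simp add: Id_E)
    assume s: "s \<in> hom J a b"
    show "mor ?F s \<in> hom C (ob ?F a) (ob ?F b)"
      using hom_ED(3)[OF FD(4)[OF s]] by simp
    assume t: "t \<in> hom J b c"
    show "mor ?F (t \<cdot>\<^bsub>J\<^esub> s) = mor ?F t \<cdot> mor ?F s"
      using und_Comp[OF FD(4)[OF s] FD(4)[OF t]] FD(6)[OF s t] by simp
  qed (rule J.category_axioms, rule category_axioms)
  then obtain l p where lp: "limit_cone J C ?F l p"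
    using CM1_limits J unfolding has_finite_limits_def by blast
  then have p: "p j \<in> hom C l (Cod C (ob F j))" if "j \<in> Obj J" for j
    using that unfolding limit_cone_def cone_def by simp
  have pc: "und (mor F s) \<cdot> p j = p k" if "s \<in> hom J j k" for s j k
    using lp that unfolding limit_cone_def cone_def by simp
  have univ: "\<exists>!h. h \<in> hom C c l \<and> (\<forall>j\<in>Obj J. p j \<cdot> h = q j)" if "cone J C ?F c q" for c q
    using lp that unfolding limit_cone_def by blast
  have "cone J C ?F X (ob F)"
    unfolding cone_def using X obj hom_ED(4)[OF FD(4)] by simp
  from univ[OF this] obtain x where x: "x \<in> hom C X l" "\<And>j. j \<in> Obj J \<Longrightarrow> p j \<cdot> x = ob F j"
    and x_unique: "\<And>h. h \<in> hom C X l \<Longrightarrow> (\<And>j. j \<in> Obj J \<Longrightarrow> p j \<cdot> h = ob F j) \<Longrightarrow> h = x"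
    by blast
  have xl: "Cod C x = l" using x by (simp add: hom_def)
  let ?p = "\<lambda>j. mk x (p j) (ob F j)"
  have ph: "?p j \<in> hom E x (ob F j)" if "j \<in> Obj J" for j
    using mk_hom x p that by blast
  have "limit_cone J E F x ?p"
    unfolding limit_cone_def
  proof (intro conjI allI impI)
    have "mor F s \<cdot>\<^bsub>E\<^esub> ?p j = ?p k" if "s \<in> hom J j k" for s j k
      using hom_ED(5)[OF FD(4)[OF that]] pc[OF that] Comp_E by metis
    then show "cone J E F x ?p"
      unfolding cone_def using ph Obj_EI[OF x(1)] by blast
  next
    fix c q assume cq: "cone J E F c q"
    then have c: "c \<in> hom C X (Cod C c)" and q: "\<And>j. j \<in> Obj J \<Longrightarrow> q j \<in> hom E c (ob F j)"
      and qc: "\<And>s j k. s \<in> hom J j k \<Longrightarrow> mor F s \<cdot>\<^bsub>E\<^esub> q j = q k"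
      unfolding cone_def Obj_E_iff by blast+
    have "und (mor F s) \<cdot> und (q j) = und (q k)" if "s \<in> hom J j k" for s j k
      using und_Comp[OF q FD(4)[OF that]] qc[OF that] that J.hom_ObjD by metis
    then have "cone J C ?F (Cod C c) (\<lambda>j. und (q j))"
      unfolding cone_def using c hom_ObjD hom_ED(3)[OF q] by auto
    from univ[OF this] obtain h where h: "h \<in> hom C (Cod C c) l" "\<And>j. j \<in> Obj J \<Longrightarrow> p j \<cdot> h = und (q j)"
      and h_unique: "\<And>k. k \<in> hom C (Cod C c) l \<Longrightarrow> (\<And>j. j \<in> Obj J \<Longrightarrow> p j \<cdot> k = und (q j)) \<Longrightarrow> k = h"
      by blast
    \<comment> \<open>The mediating map lies under \<open>X\<close> because
      \<open>h \<cdot> c\<close> has the components that characterise \<open>x\<close>.\<close>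
    have "h \<cdot> c = x"
      using x_unique[OF Comp_hom[OF c h(1)]] Comp_assoc[OF c h(1) p] h(2) hom_ED(4)[OF q] by simp
    then have hh: "mk c h x \<in> hom E c x" using mk_hom c h by blast
    show "\<exists>!h. h \<in> hom E c x \<and> (\<forall>j\<in>Obj J. ?p j \<cdot>\<^bsub>E\<^esub> h = q j)"
    proof (intro ex1I conjI ballI)
      show "mk c h x \<in> hom E c x" by (rule hh)
      show "?p j \<cdot>\<^bsub>E\<^esub> mk c h x = q j" if "j \<in> Obj J" for j
        using h(2)[OF that] hom_ED(5)[OF q[OF that]] by simp
      fix k assume k: "k \<in> hom E c x \<and> (\<forall>j\<in>Obj J. ?p j \<cdot>\<^bsub>E\<^esub> k = q j)"
      then have "und k \<in> hom C (Cod C c) l" using hom_ED(3) xl by blast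
      moreover have "p j \<cdot> und k = und (q j)" if "j \<in> Obj J" for j
        using k und_Comp[of k c x "?p j" "ob F j"] ph[OF that] that by simp
      ultimately have "und k = h" using h_unique by blast
      then show "k = mk c h x" using hom_ED(5) k by metis
    qed
  qed
  then show "\<exists>l p. limit_cone J E F l p" by blast
qed

text \<open>A cocone under a diagram in the coslice is a cocone under its underlying diagram in \<open>C\<close>, extended by
  \<open>X\<close> as the value at an adjoined initial index.\<close>

lemma has_finite_colimits_E: "has_finite_colimits E"
  unfolding has_finite_colimits_def
proof (intro allI impI)
  fix J :: "(nat, nat) cat" and F
  assume J: "finite (Obj J) \<and> finite (Mor J) \<and> is_functor J E F"
  then have F: "is_functor J E F" by simp
  note FD = is_functorD[OF F]
  interpret J: category J by (rule FD)
  interpret E: category E by (rule category_E)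
  let ?J = "adjoin_initial J"
  \<comment> \<open>Halving \<open>2 * j + 1\<close> gives \<open>j\<close>, whose structure map is
    the image of the new morphism; halving \<open>2 * s + 2\<close> gives \<open>s + 1\<close>,
    hence the subtraction of \<open>1\<close>.\<close>
  let ?F = "\<lparr>ob = case_nat X (\<lambda>j. Cod C (ob F j)),
    mor = \<lambda>m. if m = 0 then Id C X else if even m then und (mor F (m div 2 - 1)) else ob F (m div 2)\<rparr>"
  have obj: "ob F j \<in> hom C X (Cod C (ob F j))" if "j \<in> Obj J" for j
    using FD(3)[OF that] by (simp add: Obj_E_iff)
  have "is_functor ?J C ?F"
    unfolding is_functor_def
  proof (intro conjI ballI allI)
    fix a b c s t
    show "a \<in> Obj ?J \<Longrightarrow> ob ?F a \<in> Obj C"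
      using X hom_ObjD(2)[OF obj] by auto
    show "a \<in> Obj ?J \<Longrightarrow> mor ?F (Id ?J a) = Id C (ob ?F a)"
      using FD(5) by (auto simp: Id_E)
    assume s: "s \<in> hom ?J a b"
    show "mor ?F s \<in> hom C (ob ?F a) (ob ?F b)"
      using s Id_hom[OF X] obj hom_ED(3)[OF FD(4)] by (auto simp: hom_adjoin_initial)
    assume t: "t \<in> hom ?J b c"
    show "mor ?F (t \<cdot>\<^bsub>?J\<^esub> s) = mor ?F t \<cdot> mor ?F s"
    proof -
      consider "a = 0" "b = 0" "s = 0"
        | j where "j \<in> Obj J" "s = Suc (2 * j)" "b = Suc j"
        | j k s' where "s' \<in> hom J j k" "s = Suc (Suc (2 * s'))" "b = Suc k"
        using s unfolding hom_adjoin_initial by blast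
      then show ?thesis
      proof cases
        case 1
        then show ?thesis using t Id_Comp[OF Id_hom[OF X]] Comp_Id[OF obj] by (auto simp: hom_adjoin_initial)
      next
        case 2
        \<comment> \<open>Respecting the composite of a new morphism out of \<open>0\<close> with an
          old morphism says precisely that the latter commutes with the structure maps from
          \<open>X\<close>.\<close>
        then obtain k t' where t': "t' \<in> hom J j k" "t = Suc (Suc (2 * t'))"
          using t unfolding hom_adjoin_initial by blast
        then have "Cod J t' = k" by (simp add: hom_def)
        then show ?thesis using 2 t' hom_ED(4)[OF FD(4)[OF t'(1)]] by simp
      next
        case 3
        then obtain l t' where "t' \<in> hom J k l" "t = Suc (Suc (2 * t'))"
          using t 3 unfolding hom_adjoin_initial by blast
        then show ?thesis using 3 und_Comp[OF FD(4) FD(4)] FD(6) by simp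
      qed
    qed
  qed (rule category_adjoin_initial, rule J.category_axioms, rule category_axioms)
  moreover have "finite (Obj ?J)" "finite (Mor ?J)" using J by (simp_all add: adjoin_initial_def)
  ultimately obtain l p where lp: "colimit_cocone ?J C ?F l p"
    using CM1_colimits unfolding has_finite_colimits_def by blast
  \<comment> \<open>The leg at the adjoined index starts at \<open>X\<close>, so it makes the
    colimit an object under \<open>X\<close>; the new morphisms make the other legs maps under
    \<open>X\<close>.\<close>
  let ?x = "p 0"
  have l: "l \<in> Obj C" and x: "?x \<in> hom C X l"
    using lp unfolding colimit_cocone_def cocone_def by auto
  have p: "p (Suc j) \<in> hom C (Cod C (ob F j)) l" if "j \<in> Obj J" for j
    using lp that unfolding colimit_cocone_def cocone_def by auto
  have cocone: "p k \<cdot> mor ?F s = p j" if "s \<in> hom ?J j k" for s j k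
    using lp that unfolding colimit_cocone_def cocone_def by blast
  have px: "p (Suc j) \<cdot> ob F j = ?x" if "j \<in> Obj J" for j
    using cocone[of "Suc (2 * j)" 0 "Suc j"] that by (simp add: hom_adjoin_initial)
  have pc: "p (Suc k) \<cdot> und (mor F s) = p (Suc j)" if "s \<in> hom J j k" for s j k
    using cocone[of "Suc (Suc (2 * s))" "Suc j" "Suc k"] that by (simp add: hom_adjoin_initial)
  have univ: "\<exists>!h. h \<in> hom C l c \<and> (\<forall>j\<in>Obj ?J. h \<cdot> p j = q j)" if "cocone ?J C ?F c q" for c q
    using lp that unfolding colimit_cocone_def by blast
  have xl: "Cod C ?x = l" using x by (simp add: hom_def)
  let ?p = "\<lambda>j. mk (ob F j) (p (Suc j)) ?x"
  have ph: "?p j \<in> hom E (ob F j) ?x" if "j \<in> Obj J" for j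
    using mk_hom obj p px that by blast
  have "colimit_cocone J E F ?x ?p"
    unfolding colimit_cocone_def
  proof (intro conjI allI impI)
    have "?p k \<cdot>\<^bsub>E\<^esub> mor F s = ?p j" if "s \<in> hom J j k" for s j k
      using hom_ED(5)[OF FD(4)[OF that]] pc[OF that] Comp_E by metis
    then show "cocone J E F ?x ?p"
      unfolding cocone_def using ph Obj_EI[OF x(1)] by blast
  next
    fix c q assume cq: "cocone J E F c q"
    then have c: "c \<in> hom C X (Cod C c)" and q: "\<And>j. j \<in> Obj J \<Longrightarrow> q j \<in> hom E (ob F j) c"
      and qc: "\<And>s j k. s \<in> hom J j k \<Longrightarrow> q k \<cdot>\<^bsub>E\<^esub> mor F s = q j"
      unfolding cocone_def Obj_E_iff by blast+
    \<comment> \<open>The structure map \<open>c\<close> is the leg at the adjoined index. The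
      mediating map \<open>h\<close> therefore satisfies \<open>h \<cdot> ?x = c\<close>, which is
      what makes it a morphism of the coslice.\<close>
    let ?q = "case_nat c (\<lambda>j. und (q j))"
    have "und (q k) \<cdot> und (mor F s) = und (q j)" if "s \<in> hom J j k" for s j k
      using und_Comp[OF FD(4)[OF that] q] qc[OF that] that J.hom_ObjD by metis
    then have "cocone ?J C ?F (Cod C c) ?q"
      unfolding cocone_def using c hom_ObjD hom_ED(3,4)[OF q] Comp_Id[OF c]
      by (auto simp: hom_adjoin_initial)
    from univ[OF this] obtain h where h: "h \<in> hom C l (Cod C c)" "\<And>j. j \<in> Obj ?J \<Longrightarrow> h \<cdot> p j = ?q j"
      and h_unique: "\<And>k. k \<in> hom C l (Cod C c) \<Longrightarrow> (\<And>j. j \<in> Obj ?J \<Longrightarrow> k \<cdot> p j = ?q j) \<Longrightarrow> k = h"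
      by blast
    have "h \<cdot> ?x = c" and hq: "\<And>j. j \<in> Obj J \<Longrightarrow> h \<cdot> p (Suc j) = und (q j)"
      using h(2)[of 0] h(2)[of "Suc _"] by auto
    then have hh: "mk ?x h c \<in> hom E ?x c" using mk_hom x h by blast
    show "\<exists>!h. h \<in> hom E ?x c \<and> (\<forall>j\<in>Obj J. h \<cdot>\<^bsub>E\<^esub> ?p j = q j)"
    proof (intro ex1I conjI ballI)
      show "mk ?x h c \<in> hom E ?x c" by (rule hh)
      show "mk ?x h c \<cdot>\<^bsub>E\<^esub> ?p j = q j" if "j \<in> Obj J" for j
        using hq[OF that] hom_ED(5)[OF q[OF that]] by simp
      fix k assume k: "k \<in> hom E ?x c \<and> (\<forall>j\<in>Obj J. k \<cdot>\<^bsub>E\<^esub> ?p j = q j)"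
      then have "und k \<in> hom C l (Cod C c)" using hom_ED(3) xl by metis
      moreover have "und k \<cdot> p (Suc j) = und (q j)" if "j \<in> Obj J" for j
        using k und_Comp[OF ph[OF that]] that by fastforce
      moreover have "und k \<cdot> ?x = c" using k hom_ED(4) by blast
      ultimately have "und k = h" by (intro h_unique) auto
      then show "k = mk ?x h c" using hom_ED(5) k by metis
    qed
  qed
  then show "\<exists>l p. colimit_cocone J E F l p" by blast
qed

section \<open>The model axioms, checked on underlying maps\<close>

lemma retract_of_und:
  assumes "retract_of E f g"
  shows "retract_of C (und f) (und g)"
proof -
  obtain a b c d s r s' r' where *: "s \<in> hom E a c" "r \<in> hom E c a" "s' \<in> hom E b d" "r' \<in> hom E d b"
    "f \<in> hom E a b" "g \<in> hom E c d" "r \<cdot>\<^bsub>E\<^esub> s = Id E a" "r' \<cdot>\<^bsub>E\<^esub> s' = Id E b"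
    "g \<cdot>\<^bsub>E\<^esub> s = s' \<cdot>\<^bsub>E\<^esub> f" "f \<cdot>\<^bsub>E\<^esub> r = r' \<cdot>\<^bsub>E\<^esub> g"
    using assms unfolding retract_of_def by auto
  have e: "und r \<cdot> und s = Id C (Cod C a)" "und r' \<cdot> und s' = Id C (Cod C b)"
    using * und_Comp by (metis und_mk Id_E)+
  have e': "und g \<cdot> und s = und s' \<cdot> und f" "und f \<cdot> und r = und r' \<cdot> und g"
    using * und_Comp by metis+
  show ?thesis
    unfolding retract_of_def
    by (rule exI[of _ "Cod C a"], rule exI[of _ "Cod C b"], rule exI[of _ "Cod C c"], rule exI[of _ "Cod C d"],
        rule bexI[of _ "und s"], rule bexI[of _ "und r"], rule bexI[of _ "und s'"], rule bexI[of _ "und r'"])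
      (simp_all add: * e e' hom_ED(3))
qed

lemma has_lifting_E:
  assumes i: "i \<in> Mor E" and p: "p \<in> Mor E" and lift: "has_lifting C (und i) (und p)"
  shows "has_lifting E i p"
proof -
  obtain a b c d where i: "i \<in> hom E a b" and p: "p \<in> hom E c d" using i p by (simp add: hom_def)
  have D: "Dom E i = a" "Cod E i = b" "Dom E p = c" "Cod E p = d"
    "Dom C (und i) = Cod C a" "Cod C (und i) = Cod C b" "Dom C (und p) = Cod C c" "Cod C (und p) = Cod C d"
    using i p hom_ED(3)[OF i] hom_ED(3)[OF p] by (auto simp: hom_def)
  show ?thesis
    unfolding has_lifting_def D
  proof (intro ballI impI)
    fix u v assume u: "u \<in> hom E a c" and v: "v \<in> hom E b d" and e: "p \<cdot>\<^bsub>E\<^esub> u = v \<cdot>\<^bsub>E\<^esub> i"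
    have "und p \<cdot> und u = und v \<cdot> und i" using e und_Comp u v i p by metis
    then obtain h where h: "h \<in> hom C (Cod C b) (Cod C c)" "h \<cdot> und i = und u" "und p \<cdot> h = und v"
      using lift hom_ED(3)[OF u] hom_ED(3)[OF v] unfolding has_lifting_def D by blast
    \<comment> \<open>A diagonal found in \<open>C\<close> lies under \<open>X\<close> because its
      upper triangle commutes and \<open>i\<close> and \<open>u\<close> lie under
      \<open>X\<close>.\<close>
    have "h \<cdot> b = c"
      using Comp_assoc[OF hom_ED(1)[OF i] hom_ED(3)[OF i] h(1)] hom_ED(4)[OF i] hom_ED(4)[OF u] h(2) by simp
    then have "mk b h c \<in> hom E b c" using mk_hom hom_ED(2)[OF i] h by blast
    moreover have "mk b h c \<cdot>\<^bsub>E\<^esub> i = u" "p \<cdot>\<^bsub>E\<^esub> mk b h c = v"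
      using h hom_ED(5) i p u v Comp_E by metis+
    ultimately show "\<exists>h\<in>hom E b c. h \<cdot>\<^bsub>E\<^esub> i = u \<and> p \<cdot>\<^bsub>E\<^esub> h = v" by blast
  qed
qed

text \<open>The middle object of a factorization in \<open>C\<close> becomes an object under
  \<open>X\<close> through \<open>i \<cdot> a\<close>.\<close>

lemma factor_E:
  assumes f: "f \<in> hom E a b" and i: "i \<in> hom C (Cod C a) c" and p: "p \<in> hom C c (Cod C b)"
    and e: "und f = p \<cdot> i"
  shows "mk a i (i \<cdot> a) \<in> hom E a (i \<cdot> a)" "mk (i \<cdot> a) p b \<in> hom E (i \<cdot> a) b"
    "f = mk (i \<cdot> a) p b \<cdot>\<^bsub>E\<^esub> mk a i (i \<cdot> a)"
proof -
  note a = hom_ED(1)[OF f]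
  show "mk a i (i \<cdot> a) \<in> hom E a (i \<cdot> a)" using mk_hom a i by blast
  show "mk (i \<cdot> a) p b \<in> hom E (i \<cdot> a) b"
    using mk_hom[OF Comp_hom[OF a i] p] Comp_assoc[OF a i p] hom_ED(4)[OF f] e by simp
  show "f = mk (i \<cdot> a) p b \<cdot>\<^bsub>E\<^esub> mk a i (i \<cdot> a)" using hom_ED(5)[OF f] e by simp
qed

lemma closed_model_category_E: "closed_model_category E"
proof (intro closed_model_category.intro closed_model_category_axioms.intro)
  show "category E" by (rule category_E)
  show "has_finite_limits E" by (rule has_finite_limits_E)
  show "has_finite_colimits E" by (rule has_finite_colimits_E)
  show "weq E \<subseteq> Mor E" "cof E \<subseteq> Mor E" "fib E \<subseteq> Mor E"
    by (auto simp: weq_E cof_E fib_E)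
next
  fix f g a b c assume f: "f \<in> hom E a b" and g: "g \<in> hom E b c"
  have gf: "g \<cdot>\<^bsub>E\<^esub> f \<in> hom E a c" using category.Comp_hom[OF category_E f g] .
  have w: "m \<in> weq E \<longleftrightarrow> und m \<in> weq C" if "m \<in> hom E a b" for m a b
    using that by (simp add: weq_E hom_def)
  note w' = w[OF f] w[OF g] w[OF gf] und_Comp[OF f g]
  note fg = hom_ED(3)[OF f] hom_ED(3)[OF g]
  show "f \<in> weq E \<Longrightarrow> g \<in> weq E \<Longrightarrow> g \<cdot>\<^bsub>E\<^esub> f \<in> weq E"
    "f \<in> weq E \<Longrightarrow> g \<cdot>\<^bsub>E\<^esub> f \<in> weq E \<Longrightarrow> g \<in> weq E"
    "g \<in> weq E \<Longrightarrow> g \<cdot>\<^bsub>E\<^esub> f \<in> weq E \<Longrightarrow> f \<in> weq E"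
    using CM2_comp[OF fg] CM2_left[OF fg] CM2_right[OF fg] unfolding w' by blast+
next
  fix f g assume r: "retract_of E f g"
  then have "f \<in> Mor E" by (auto simp: retract_of_def hom_def)
  then show "g \<in> weq E \<Longrightarrow> f \<in> weq E" "g \<in> cof E \<Longrightarrow> f \<in> cof E" "g \<in> fib E \<Longrightarrow> f \<in> fib E"
    using retract_of_und[OF r] CM3_weq CM3_cof CM3_fib by (auto simp: weq_E cof_E fib_E)
next
  fix i p
  show "i \<in> cof E \<inter> weq E \<Longrightarrow> p \<in> fib E \<Longrightarrow> has_lifting E i p"
    "i \<in> cof E \<Longrightarrow> p \<in> fib E \<inter> weq E \<Longrightarrow> has_lifting E i p"
    using CM4_acyclic_cof CM4_acyclic_fib by (auto simp: weq_E cof_E fib_E intro!: has_lifting_E)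
next
  fix f a b assume f: "f \<in> hom E a b"
  note fact = factor_E[OF f]
  show "\<exists>c. \<exists>i\<in>hom E a c. \<exists>p\<in>hom E c b. i \<in> cof E \<inter> weq E \<and> p \<in> fib E \<and> f = p \<cdot>\<^bsub>E\<^esub> i"
  proof -
    obtain c i p where "i \<in> hom C (Cod C a) c" "p \<in> hom C c (Cod C b)" "i \<in> cof C \<inter> weq C" "p \<in> fib C" "und f = p \<cdot> i"
      using CM5_acyclic_cof[OF hom_ED(3)[OF f]] by blast
    then show ?thesis using fact[of i c p] mk_in_model by blast
  qed
  show "\<exists>c. \<exists>i\<in>hom E a c. \<exists>p\<in>hom E c b. i \<in> cof E \<and> p \<in> fib E \<inter> weq E \<and> f = p \<cdot>\<^bsub>E\<^esub> i"
  proof -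
    obtain c i p where "i \<in> hom C (Cod C a) c" "p \<in> hom C c (Cod C b)" "i \<in> cof C" "p \<in> fib C \<inter> weq C" "und f = p \<cdot> i"
      using CM5_acyclic_fib[OF hom_ED(3)[OF f]] by blast
    then show ?thesis using fact[of i c p] mk_in_model by blast
  qed
qed

section \<open>Cofibrant and fibrant objects of the coslice\<close>

lemma cofibrant_E_iff: "cofibrant E u \<longleftrightarrow> u \<in> cof C \<and> Dom C u = X"
proof (cases "u \<in> Obj E")
  case True
  then have u: "u \<in> hom C X (Cod C u)" by (simp add: Obj_E_iff)
  \<comment> \<open>The map from the initial object to \<open>u\<close> has \<open>u\<close> itself
    as underlying map.\<close>
  have m: "mk (Id C X) u u \<in> hom E (Id C X) u" using mk_hom[OF Id_hom[OF X] u Comp_Id[OF u]] .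
  show ?thesis
    using closed_model_category.cofibrant_iff[OF closed_model_category_E initial_object_Id m]
      mk_in_model[OF m] u by (simp add: hom_def)
next
  case False
  then show ?thesis using cof_Mor by (auto simp: cofibrant_def Obj_E)
qed

lemma terminal_object_E:
  assumes t: "terminal_object C t" and x: "x \<in> hom C X t"
  shows "terminal_object E x"
  unfolding terminal_object_def
proof (intro conjI ballI)
  have T: "\<exists>!f. f \<in> hom C a t" if "a \<in> Obj C" for a
    using t that unfolding terminal_object_def by blast
  have xt: "Cod C x = t" using x by (simp add: hom_def)
  show "x \<in> Obj E" using Obj_EI[OF x] .
  fix a assume "a \<in> Obj E"
  then have a: "a \<in> hom C X (Cod C a)" by (simp add: Obj_E_iff)
  then obtain f where f: "f \<in> hom C (Cod C a) t" using T hom_ObjD by blast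
  have "f \<cdot> a = x" using T[OF X] Comp_hom[OF a f] x by blast
  then have "mk a f x \<in> hom E a x" using mk_hom a f by blast
  moreover have "m = mk a f x" if "m \<in> hom E a x" for m
    using hom_ED(3,5)[OF that] f T a hom_ObjD xt by metis
  ultimately show "\<exists>!f. f \<in> hom E a x" by blast
qed

text \<open>The terminal object of the coslice lies over that of \<open>C\<close>, so the map from
  \<open>v\<close> to it has the map from \<open>Cod C v\<close> to the terminal object of
  \<open>C\<close> underneath.\<close>

lemma fibrant_E_Cod:
  assumes "fibrant E v"
  shows "fibrant C (Cod C v)"
proof -
  obtain t where t: "terminal_object C t" using terminal_object_exists by blast
  have v: "v \<in> hom C X (Cod C v)" using assms unfolding fibrant_def Obj_E_iff by blast
  obtain f where f: "f \<in> hom C (Cod C v) t"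
    using t v hom_ObjD unfolding terminal_object_def by blast
  have m: "mk v f (f \<cdot> v) \<in> hom E v (f \<cdot> v)" using mk_hom v f by blast
  have "terminal_object E (f \<cdot> v)" using terminal_object_E[OF t] Comp_hom v f by blast
  then have "f \<in> fib C"
    using fibrant_iff[OF closed_model_category_E _ m] assms mk_in_model[OF m] by blast
  then show ?thesis using fibrant_iff[OF closed_model_category_axioms t f] by blast
qed

end

section \<open>Change of base object\<close>

text \<open>Assumes the formulas of \<open>cobase_change_adj\<close> for an abstract
  \<open>mk\<close>, so that the dual of \<open>base_change_adj\<close> is an instance as
  well.\<close>

locale cobase_change = closed_model_category C + X: coslice_like C X E mk + Y: coslice_like C Y E' mk
  for C :: "('o, 'm, 'z) model_cat_scheme"  (structure) and X Y E E' mk +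
  fixes g :: 'm and i j :: "'m \<Rightarrow> 'm" and A :: "('m, 'm \<times> 'm \<times> 'm, 'm, 'm \<times> 'm \<times> 'm) adj"
  assumes g: "g \<in> hom C X Y"
    and pushout: "u \<in> Obj E \<Longrightarrow> pushout C g u (i u) (j u)"
    and left_ob [simp]: "ob (left A) u = i u"
    and left_mor: "mor (left A) (mk u \<alpha> u') = mk (i u)
      (THE h. h \<in> hom C (Cod C (i u)) (Cod C (i u')) \<and> h \<cdot> i u = i u' \<and> h \<cdot> j u = j u' \<cdot> \<alpha>) (i u')"
    and right_ob [simp]: "ob (right A) v = v \<cdot> g"
    and right_mor: "mor (right A) (mk v \<alpha> v') = mk (v \<cdot> g) \<alpha> (v' \<cdot> g)"
    and unit: "unit A u = mk u (j u) (i u \<cdot> g)"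
    and counit: "counit A v = mk (i (v \<cdot> g))
      (THE h. h \<in> hom C (Cod C (i (v \<cdot> g))) (Cod C v) \<and> h \<cdot> i (v \<cdot> g) = v \<and> h \<cdot> j (v \<cdot> g) = Id C (Cod C v)) v"
begin

section \<open>The change-of-base adjunction from the universal property of pushouts\<close>

lemma pushoutD:
  assumes "u \<in> Obj E"
  shows "i u \<in> hom C Y (Cod C (i u))" "j u \<in> hom C (Cod C u) (Cod C (i u))" "i u \<cdot> g = j u \<cdot> u"
    "i' \<in> hom C Y q \<Longrightarrow> j' \<in> hom C (Cod C u) q \<Longrightarrow> i' \<cdot> g = j' \<cdot> u \<Longrightarrow>
      \<exists>!h. h \<in> hom C (Cod C (i u)) q \<and> h \<cdot> i u = i' \<and> h \<cdot> j u = j'"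
proof -
  obtain x a b p where *: "g \<in> hom C x a" "u \<in> hom C x b" "i u \<in> hom C a p" "j u \<in> hom C b p"
    "i u \<cdot> g = j u \<cdot> u"
    "\<And>q i' j'. i' \<in> hom C a q \<Longrightarrow> j' \<in> hom C b q \<Longrightarrow> i' \<cdot> g = j' \<cdot> u \<Longrightarrow>
      \<exists>!h. h \<in> hom C p q \<and> h \<cdot> i u = i' \<and> h \<cdot> j u = j'"
    using pushout[OF assms] unfolding pushout_def by blast
  have "a = Y" "b = Cod C u" "p = Cod C (i u)" using * g by (auto simp: hom_def)
  with * show "i u \<in> hom C Y (Cod C (i u))" "j u \<in> hom C (Cod C u) (Cod C (i u))" "i u \<cdot> g = j u \<cdot> u"
    "i' \<in> hom C Y q \<Longrightarrow> j' \<in> hom C (Cod C u) q \<Longrightarrow> i' \<cdot> g = j' \<cdot> u \<Longrightarrow>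
      \<exists>!h. h \<in> hom C (Cod C (i u)) q \<and> h \<cdot> i u = i' \<and> h \<cdot> j u = j'"
    by simp_all
qed

lemma hom_ObjD_E: "m \<in> hom E u u' \<Longrightarrow> u \<in> Obj E" "m \<in> hom E u u' \<Longrightarrow> u' \<in> Obj E"
  using category.hom_ObjD[OF X.category_E] by blast+

lemma hom_ObjD_E': "m \<in> hom E' v v' \<Longrightarrow> v \<in> Obj E'" "m \<in> hom E' v v' \<Longrightarrow> v' \<in> Obj E'"
  using category.hom_ObjD[OF Y.category_E] by blast+

lemma i_Obj: "u \<in> Obj E \<Longrightarrow> i u \<in> Obj E'"
  using Y.Obj_EI pushoutD(1) .

lemma comp_g_Obj: "v \<in> Obj E' \<Longrightarrow> v \<cdot> g \<in> hom C X (Cod C v)" "v \<in> Obj E' \<Longrightarrow> v \<cdot> g \<in> Obj E"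
  "v \<in> Obj E' \<Longrightarrow> Cod C (v \<cdot> g) = Cod C v"
  using X.Obj_EI Comp_hom[OF g, of v "Cod C v"] Y.Obj_E_iff by (auto simp: hom_def)

text \<open>The uniqueness half of the pushout property. Every equation between maps out of
  \<open>g\<^sub>!(u)\<close> below is checked after precomposing with \<open>j u\<close>.\<close>

lemma left_eqI:
  assumes u: "u \<in> Obj E" and m: "m \<in> hom E' (i u) v" and n: "n \<in> hom E' (i u) v"
    and e: "und m \<cdot> j u = und n \<cdot> j u"
  shows "m = n"
proof -
  note m' = Y.hom_ED[OF m] and n' = Y.hom_ED[OF n]
  \<comment> \<open>Both underlying maps mediate for the cocone with legs \<open>v\<close> and
    \<open>und m \<cdot> j u\<close>, whose compatibility is shown here.\<close>
  have "v \<cdot> g = (und m \<cdot> j u) \<cdot> u"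
    using m'(4) pushoutD(3)[OF u] Comp_assoc[OF g m'(1) m'(3)]
      Comp_assoc[OF X.Obj_E_iff[THEN iffD1, OF u] pushoutD(2)[OF u] m'(3)] by simp
  with pushoutD(4)[OF u m'(2) Comp_hom[OF pushoutD(2)[OF u] m'(3)]]
  have "und m = und n" using m'(3,4) n'(3,4) e by metis
  then show ?thesis using Y.eqI_E m n by blast
qed

lemma left_mor_hom:
  assumes m: "m \<in> hom E u u'"
  shows "mor (left A) m \<in> hom E' (i u) (i u')" "und (mor (left A) m) \<cdot> j u = j u' \<cdot> und m"
proof -
  note m' = X.hom_ED[OF m] and u = hom_ObjD_E(1)[OF m] and u' = hom_ObjD_E(2)[OF m]
  \<comment> \<open>Compatibility of the legs \<open>i u'\<close> and
    \<open>j u' \<cdot> und m\<close> gives unique existence, so the \<open>THE\<close> in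
    \<open>left_mor\<close> denotes the mediating map.\<close>
  have "i u' \<cdot> g = (j u' \<cdot> und m) \<cdot> u"
    using pushoutD(3)[OF u'] m'(4) Comp_assoc[OF m'(1,3) pushoutD(2)[OF u']] by simp
  with pushoutD(4)[OF u pushoutD(1)[OF u'] Comp_hom[OF m'(3) pushoutD(2)[OF u']]]
  have "\<exists>!h. h \<in> hom C (Cod C (i u)) (Cod C (i u')) \<and> h \<cdot> i u = i u' \<and> h \<cdot> j u = j u' \<cdot> und m"
    by blast
  from theI'[OF this] show "mor (left A) m \<in> hom E' (i u) (i u')"
    "und (mor (left A) m) \<cdot> j u = j u' \<cdot> und m"
    using m'(5) left_mor[of u "und m" u'] Y.mk_hom[OF pushoutD(1)[OF u]] by auto
qed

lemma counit_hom:
  assumes v: "v \<in> Obj E'"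
  shows "counit A v \<in> hom E' (i (v \<cdot> g)) v" "und (counit A v) \<cdot> j (v \<cdot> g) = Id C (Cod C v)"
proof -
  note vg = comp_g_Obj[OF v]
  have v': "v \<in> hom C Y (Cod C v)" using v by (simp add: Y.Obj_E_iff)
  have "Id C (Cod C v) \<in> hom C (Cod C (v \<cdot> g)) (Cod C v)"
    using vg Id_hom hom_ObjD by metis
  with pushoutD(4)[OF vg(2) v' this]
  have "\<exists>!h. h \<in> hom C (Cod C (i (v \<cdot> g))) (Cod C v) \<and> h \<cdot> i (v \<cdot> g) = v \<and> h \<cdot> j (v \<cdot> g) = Id C (Cod C v)"
    using Id_Comp[OF vg(1)] by simp
  from theI'[OF this] show "counit A v \<in> hom E' (i (v \<cdot> g)) v"
    "und (counit A v) \<cdot> j (v \<cdot> g) = Id C (Cod C v)"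
    using Y.mk_hom[OF pushoutD(1)[OF vg(2)]] by (auto simp: counit)
qed

lemma right_mor_hom:
  assumes m: "m \<in> hom E' v v'"
  shows "mor (right A) m \<in> hom E (v \<cdot> g) (v' \<cdot> g)" "und (mor (right A) m) = und m"
proof -
  note m' = Y.hom_ED[OF m] and v = hom_ObjD_E'(1)[OF m]
  have e: "mor (right A) m = mk (v \<cdot> g) (und m) (v' \<cdot> g)"
    using m'(5) right_mor by metis
  show "mor (right A) m \<in> hom E (v \<cdot> g) (v' \<cdot> g)"
    unfolding e using X.mk_hom[OF comp_g_Obj(1)[OF v] m'(3)] Comp_assoc[OF g m'(1,3)] m'(4) by simp
  show "und (mor (right A) m) = und m" by (simp add: e)
qed

lemma unit_hom: "u \<in> Obj E \<Longrightarrow> unit A u \<in> hom E u (i u \<cdot> g)"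
  unfolding unit using X.mk_hom[of u "Cod C u" "j u"] pushoutD(2,3) X.Obj_E_iff by metis

lemma adjunction_cobase: "adjunction E E' A"
proof -
  interpret E: category E by (rule X.category_E)
  interpret E': category E' by (rule Y.category_E)
  have Id_E': "und (Id E' v) = Id C (Cod C v)" for v by (simp add: Y.Id_E)
  have Id_EE: "und (Id E u) = Id C (Cod C u)" for u by (simp add: X.Id_E)
  have L: "is_functor E E' (left A)"
    unfolding is_functor_def left_ob
  proof (intro conjI ballI allI)
    fix a assume a: "a \<in> Obj E"
    show "i a \<in> Obj E'" by (rule i_Obj[OF a])
    show "mor (left A) (Id E a) = Id E' (i a)"
      using left_eqI[OF a left_mor_hom(1)[OF E.Id_hom[OF a]] E'.Id_hom[OF i_Obj[OF a]]]
        left_mor_hom(2)[OF E.Id_hom[OF a]] Id_Comp[OF pushoutD(2)[OF a]] Comp_Id[OF pushoutD(2)[OF a]]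
      by (simp add: Id_E' Id_EE)
  next
    fix a b f assume "f \<in> hom E a b"
    then show "mor (left A) f \<in> hom E' (i a) (i b)" by (rule left_mor_hom)
  next
    fix a b c s t assume s: "s \<in> hom E a b" and t: "t \<in> hom E b c"
    note a = hom_ObjD_E(1)[OF s] and b = hom_ObjD_E(1)[OF t] and c = hom_ObjD_E(2)[OF t]
    note Ls = left_mor_hom[OF s] and Lt = left_mor_hom[OF t]
    note s' = X.hom_ED(3)[OF s] and t' = X.hom_ED(3)[OF t]
    note Ls' = Y.hom_ED(3)[OF Ls(1)] and Lt' = Y.hom_ED(3)[OF Lt(1)]
    have "(und (mor (left A) t) \<cdot> und (mor (left A) s)) \<cdot> j a = und (mor (left A) t) \<cdot> (j b \<cdot> und s)"
      using Comp_assoc[OF pushoutD(2)[OF a] Ls' Lt'] Ls(2) by simp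
    also have "\<dots> = j c \<cdot> (und t \<cdot> und s)"
      using Comp_assoc[OF s' pushoutD(2)[OF b] Lt'] Lt(2) Comp_assoc[OF s' t' pushoutD(2)[OF c]] by simp
    finally show "mor (left A) (t \<cdot>\<^bsub>E\<^esub> s) = mor (left A) t \<cdot>\<^bsub>E'\<^esub> mor (left A) s"
      using left_eqI[OF a left_mor_hom(1)[OF E.Comp_hom[OF s t]] E'.Comp_hom[OF Ls(1) Lt(1)]]
        left_mor_hom(2)[OF E.Comp_hom[OF s t]] X.und_Comp[OF s t] Y.und_Comp[OF Ls(1) Lt(1)] by simp
  qed (rule X.category_E, rule Y.category_E)
  have R: "is_functor E' E (right A)"
    unfolding is_functor_def right_ob
  proof (intro conjI ballI allI)
    fix a assume a: "a \<in> Obj E'"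
    show "a \<cdot> g \<in> Obj E" by (rule comp_g_Obj(2)[OF a])
    show "mor (right A) (Id E' a) = Id E (a \<cdot> g)"
      using comp_g_Obj(3)[OF a] by (simp add: X.Id_E Y.Id_E right_mor)
  next
    fix a b f assume "f \<in> hom E' a b"
    then show "mor (right A) f \<in> hom E (a \<cdot> g) (b \<cdot> g)" by (rule right_mor_hom)
  next
    fix a b c s t assume s: "s \<in> hom E' a b" and t: "t \<in> hom E' b c"
    note Rs = right_mor_hom[OF s] and Rt = right_mor_hom[OF t]
    show "mor (right A) (t \<cdot>\<^bsub>E'\<^esub> s) = mor (right A) t \<cdot>\<^bsub>E\<^esub> mor (right A) s"
      using X.eqI_E[OF right_mor_hom(1)[OF E'.Comp_hom[OF s t]] E.Comp_hom[OF Rs(1) Rt(1)]]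
        right_mor_hom(2)[OF E'.Comp_hom[OF s t]] Rs(2) Rt(2) X.und_Comp[OF Rs(1) Rt(1)] Y.und_Comp[OF s t] by simp
  qed (rule Y.category_E, rule X.category_E)
  show ?thesis
    unfolding adjunction_def left_ob right_ob
  proof (intro conjI ballI allI)
    show "is_functor E E' (left A)" by (rule L)
    show "is_functor E' E (right A)" by (rule R)
  next
    fix u assume u: "u \<in> Obj E"
    show "unit A u \<in> hom E u (i u \<cdot> g)" using unit_hom[OF u] .
    note \<eta> = left_mor_hom[OF unit_hom[OF u]] and \<epsilon> = counit_hom[OF i_Obj[OF u]]
    note iug = comp_g_Obj(2)[OF i_Obj[OF u]]
    \<comment> \<open>The defining equation of \<open>mor (left A)\<close> turns the composite into
      \<open>j (i u \<cdot> g) \<cdot> j u\<close> followed by the counit, which is a left inverse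
      of \<open>j (i u \<cdot> g)\<close>.\<close>
    have "(und (counit A (i u)) \<cdot> und (mor (left A) (unit A u))) \<cdot> j u
      = und (counit A (i u)) \<cdot> (j (i u \<cdot> g) \<cdot> j u)"
      using Comp_assoc[OF pushoutD(2)[OF u] Y.hom_ED(3)[OF \<eta>(1)] Y.hom_ED(3)[OF \<epsilon>(1)]] \<eta>(2)
      by (simp add: unit)
    also have "\<dots> = Id C (Cod C (i u)) \<cdot> j u"
      using Comp_assoc[OF _ pushoutD(2)[OF iug] Y.hom_ED(3)[OF \<epsilon>(1)]] \<epsilon>(2)
        comp_g_Obj(3)[OF i_Obj[OF u]] pushoutD(2)[OF u] by simp
    finally show "counit A (i u) \<cdot>\<^bsub>E'\<^esub> mor (left A) (unit A u) = Id E' (i u)"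
      using left_eqI[OF u E'.Comp_hom[OF \<eta>(1) \<epsilon>(1)] E'.Id_hom[OF i_Obj[OF u]]]
        Y.und_Comp[OF \<eta>(1) \<epsilon>(1)] by (simp add: Id_E')
  next
    fix a b f assume f: "f \<in> hom E a b"
    note a = hom_ObjD_E(1)[OF f] and b = hom_ObjD_E(2)[OF f]
    note Lf = left_mor_hom[OF f] note RLf = right_mor_hom[OF Lf(1)]
    show "mor (right A) (mor (left A) f) \<cdot>\<^bsub>E\<^esub> unit A a = unit A b \<cdot>\<^bsub>E\<^esub> f"
      using X.eqI_E[OF E.Comp_hom[OF unit_hom[OF a] RLf(1)] E.Comp_hom[OF f unit_hom[OF b]]]
        X.und_Comp[OF unit_hom[OF a] RLf(1)] X.und_Comp[OF f unit_hom[OF b]] RLf(2) Lf(2)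
      by (simp add: unit)
  next
    fix v assume v: "v \<in> Obj E'"
    note \<epsilon> = counit_hom[OF v] and vg = comp_g_Obj(2)[OF v]
    show "counit A v \<in> hom E' (i (v \<cdot> g)) v" by (rule \<epsilon>(1))
    show "mor (right A) (counit A v) \<cdot>\<^bsub>E\<^esub> unit A (v \<cdot> g) = Id E (v \<cdot> g)"
      using X.eqI_E[OF E.Comp_hom[OF unit_hom[OF vg] right_mor_hom(1)[OF \<epsilon>(1)]] E.Id_hom[OF vg]]
        X.und_Comp[OF unit_hom[OF vg] right_mor_hom(1)[OF \<epsilon>(1)]] right_mor_hom(2)[OF \<epsilon>(1)] \<epsilon>(2)
        comp_g_Obj(3)[OF v]
      by (simp add: unit Id_EE)
  next
    fix a b f assume f: "f \<in> hom E' a b"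
    note a = hom_ObjD_E'(1)[OF f] and b = hom_ObjD_E'(2)[OF f]
    note \<epsilon>a = counit_hom[OF a] and \<epsilon>b = counit_hom[OF b]
    note Rf = right_mor_hom[OF f] note LRf = left_mor_hom[OF Rf(1)]
    note f' = Y.hom_ED(3)[OF f]
    have ag: "a \<cdot> g \<in> Obj E" and bg: "b \<cdot> g \<in> Obj E" using comp_g_Obj a b by auto
    have "(und f \<cdot> und (counit A a)) \<cdot> j (a \<cdot> g) = und f"
      using Comp_assoc[OF pushoutD(2)[OF ag] Y.hom_ED(3)[OF \<epsilon>a(1)] f'] \<epsilon>a(2) Comp_Id[OF f'] by simp
    moreover have "(und (counit A b) \<cdot> und (mor (left A) (mor (right A) f))) \<cdot> j (a \<cdot> g)
      = und (counit A b) \<cdot> (j (b \<cdot> g) \<cdot> und f)"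
      using Comp_assoc[OF pushoutD(2)[OF ag] Y.hom_ED(3)[OF LRf(1)] Y.hom_ED(3)[OF \<epsilon>b(1)]] LRf(2) Rf(2) by simp
    moreover have "\<dots> = und f"
      using Comp_assoc[OF _ pushoutD(2)[OF bg] Y.hom_ED(3)[OF \<epsilon>b(1)]] f' comp_g_Obj(3)[OF b]
        \<epsilon>b(2) Id_Comp[OF f'] by simp
    ultimately show "f \<cdot>\<^bsub>E'\<^esub> counit A a = counit A b \<cdot>\<^bsub>E'\<^esub> mor (left A) (mor (right A) f)"
      using left_eqI[OF ag E'.Comp_hom[OF \<epsilon>a(1) f] E'.Comp_hom[OF LRf(1) \<epsilon>b(1)]]
        Y.und_Comp[OF \<epsilon>a(1) f] Y.und_Comp[OF LRf(1) \<epsilon>b(1)] by simp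
  qed
qed

text \<open>The right adjoint only changes structure maps and keeps underlying maps, so it preserves
  fibrations and weak equivalences.\<close>

lemma quillen_adjunction_cobase: "quillen_adjunction E E' A"
proof (rule quillen_adjunctionI_right[OF X.closed_model_category_E Y.closed_model_category_E adjunction_cobase])
  have *: "mor (right A) f \<in> Mor E \<and> und (mor (right A) f) = und f" if "f \<in> Mor E'" for f
    using right_mor_hom[of f "Dom E' f" "Cod E' f"] that by (simp add: hom_def)
  show "f \<in> fib E' \<Longrightarrow> mor (right A) f \<in> fib E" "f \<in> weq E' \<Longrightarrow> mor (right A) f \<in> weq E" for f
    using * by (auto simp: X.fib_E X.weq_E Y.fib_E Y.weq_E)
qed

lemma adjunct_weq_iff:
  assumes u: "u \<in> Obj E" and f: "f \<in> hom E' (i u) v"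
  shows "mor (right A) f \<cdot>\<^bsub>E\<^esub> unit A u \<in> weq E \<longleftrightarrow> und f \<cdot> j u \<in> weq C"
    "f \<in> weq E' \<longleftrightarrow> und f \<in> weq C"
proof -
  note Rf = right_mor_hom[OF f]
  have "mor (right A) f \<cdot>\<^bsub>E\<^esub> unit A u \<in> hom E u (v \<cdot> g)"
    using category.Comp_hom[OF X.category_E unit_hom[OF u] Rf(1)] .
  then show "mor (right A) f \<cdot>\<^bsub>E\<^esub> unit A u \<in> weq E \<longleftrightarrow> und f \<cdot> j u \<in> weq C"
    using X.und_Comp[OF unit_hom[OF u] Rf(1)] Rf(2) by (simp add: X.weq_E hom_def unit)
  show "f \<in> weq E' \<longleftrightarrow> und f \<in> weq C" using f by (simp add: Y.weq_E hom_def)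
qed

lemma quillen_equivalence_cobase_iff:
  "quillen_equivalence E E' A \<longleftrightarrow> (\<forall>u. cofibrant E u \<longrightarrow> j u \<in> weq C)"
proof (intro iffI allI impI)
  fix u assume qe: "quillen_equivalence E E' A" and cu: "cofibrant E u"
  interpret E': closed_model_category E' by (rule Y.closed_model_category_E)
  have u: "u \<in> Obj E" using cu unfolding cofibrant_def by blast
  obtain t where t: "terminal_object E' t" using E'.terminal_object_exists by blast
  then obtain f where "f \<in> hom E' (i u) t"
    using i_Obj[OF u] unfolding terminal_object_def by blast
  then obtain v r p where r: "r \<in> hom E' (i u) v" "r \<in> weq E'" and p: "p \<in> hom E' v t" "p \<in> fib E'"
    using E'.CM5_acyclic_cof by blast
  have "fibrant E' v" using fibrant_iff[OF E'.closed_model_category_axioms t p(1)] p by blast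
  \<comment> \<open>As a weak equivalence with fibrant target, \<open>r\<close> has an adjunct that
    is a weak equivalence, and the map underlying it is \<open>und r \<cdot> j u\<close>; cancelling
    \<open>und r\<close> leaves \<open>j u\<close>.\<close>
  then have "mor (right A) r \<cdot>\<^bsub>E\<^esub> unit A u \<in> weq E"
    using qe cu r unfolding quillen_equivalence_def by simp
  then have "und r \<cdot> j u \<in> weq C" "und r \<in> weq C" using adjunct_weq_iff[OF u r(1)] r(2) by auto
  then show "j u \<in> weq C" using CM2_right[OF pushoutD(2)[OF u] Y.hom_ED(3)[OF r(1)]] by blast
next
  assume j: "\<forall>u. cofibrant E u \<longrightarrow> j u \<in> weq C"
  have "f \<in> weq E' \<longleftrightarrow> mor (right A) f \<cdot>\<^bsub>E\<^esub> unit A u \<in> weq E"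
    if "cofibrant E u" and f: "f \<in> hom E' (i u) v" for u v f
  proof -
    have u: "u \<in> Obj E" using that unfolding cofibrant_def by blast
    have "j u \<in> weq C" using j that by blast
    then show ?thesis
      using adjunct_weq_iff[OF u f] CM2_comp[OF pushoutD(2)[OF u] Y.hom_ED(3)[OF f]]
        CM2_left[OF pushoutD(2)[OF u] Y.hom_ED(3)[OF f]] by blast
  qed
  then show "quillen_equivalence E E' A"
    unfolding quillen_equivalence_def using quillen_adjunction_cobase by simp
qed

end

section \<open>Induced adjunctions on coslices\<close>

text \<open>Two encodings \<open>mk\<close> and \<open>mk'\<close> occur because \<open>C\<close>
  and \<open>D\<close> have different types of morphisms. Both orientations of triples can be
  instantiated, so this covers slices by duality.\<close>

locale coslice_quillen_equivalence =
  C: coslice_like C X E mk + D: coslice_like D "ob (left A) X" E' mk'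
  for C :: "('o1, 'm1, 'y) model_cat_scheme" and D :: "('o2, 'm2, 'z) model_cat_scheme"
    and A :: "('o1, 'm1, 'o2, 'm2) adj" and X E E' mk mk' +
  fixes B :: "('m1, 'm1 \<times> 'm1 \<times> 'm1, 'm2, 'm2 \<times> 'm2 \<times> 'm2) adj"
  assumes qe: "quillen_equivalence C D A"
    and X_cofibrant: "cofibrant C X"
    and left_ob [simp]: "ob (left B) u = mor (left A) u"
    and left_mor [simp]: "mor (left B) (mk u \<alpha> u') = mk' (mor (left A) u) (mor (left A) \<alpha>) (mor (left A) u')"
    and right_ob [simp]: "ob (right B) v = mor (right A) v \<cdot>\<^bsub>C\<^esub> unit A X"
    and right_mor [simp]: "mor (right B) (mk' v \<beta> v') =
      mk (mor (right A) v \<cdot>\<^bsub>C\<^esub> unit A X) (mor (right A) \<beta>) (mor (right A) v' \<cdot>\<^bsub>C\<^esub> unit A X)"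
    and unit: "unit B u = mk u (unit A (Cod C u)) (mor (right A) (mor (left A) u) \<cdot>\<^bsub>C\<^esub> unit A X)"
    and counit: "counit B v = mk' (mor (left A) (mor (right A) v \<cdot>\<^bsub>C\<^esub> unit A X)) (counit A (Cod D v)) v"
begin

lemma adj: "adjunction C D A"
  using qe unfolding quillen_equivalence_def quillen_adjunction_def by blast

lemmas L = is_functorD[OF adjunctionD(1)[OF adj]] and R = is_functorD[OF adjunctionD(2)[OF adj]]
lemmas AD = adjunctionD[OF adj]

lemma left_hom:
  assumes f: "f \<in> hom E u u'"
  shows "mor (left B) f \<in> hom E' (mor (left A) u) (mor (left A) u')"
    "und (mor (left B) f) = mor (left A) (und f)"
proof -
  note f' = C.hom_ED[OF f]
  have e: "mor (left B) f = mk' (mor (left A) u) (mor (left A) (und f)) (mor (left A) u')"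
    using f'(5) left_mor by metis
  show "mor (left B) f \<in> hom E' (mor (left A) u) (mor (left A) u')"
    unfolding e using D.mk_hom[OF L(4)[OF f'(1)] L(4)[OF f'(3)]] L(6)[OF f'(1,3)] f'(4) by simp
  show "und (mor (left B) f) = mor (left A) (und f)" by (simp add: e)
qed

lemma Obj_left: "u \<in> Obj E \<Longrightarrow> mor (left A) u \<in> Obj E'" "u \<in> Obj E \<Longrightarrow> Cod D (mor (left A) u) = ob (left A) (Cod C u)"
  using L(4)[of u X "Cod C u"] D.Obj_EI by (auto simp: C.Obj_E_iff hom_def)

text \<open>The right adjoint sends \<open>v\<close> to its adjunct under \<open>A\<close>.\<close>

lemma Obj_right:
  assumes "v \<in> Obj E'"
  shows "mor (right A) v \<cdot>\<^bsub>C\<^esub> unit A X \<in> hom C X (ob (right A) (Cod D v))"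
    "mor (right A) v \<cdot>\<^bsub>C\<^esub> unit A X \<in> Obj E"
    "Cod C (mor (right A) v \<cdot>\<^bsub>C\<^esub> unit A X) = ob (right A) (Cod D v)"
  using adjunct_hom[OF adj _ C.X, of v "Cod D v"] assms C.Obj_EI D.Obj_E_iff by (auto simp: hom_def)

lemma right_hom:
  assumes f: "f \<in> hom E' v v'"
  shows "mor (right B) f \<in> hom E (mor (right A) v \<cdot>\<^bsub>C\<^esub> unit A X) (mor (right A) v' \<cdot>\<^bsub>C\<^esub> unit A X)"
    "und (mor (right B) f) = mor (right A) (und f)"
proof -
  note f' = D.hom_ED[OF f]
  have v: "v \<in> Obj E'" using f'(1) D.Obj_E_iff by blast
  have e: "mor (right B) f = mk (mor (right A) v \<cdot>\<^bsub>C\<^esub> unit A X) (mor (right A) (und f)) (mor (right A) v' \<cdot>\<^bsub>C\<^esub> unit A X)"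
    using f'(5) right_mor by metis
  show "mor (right B) f \<in> hom E (mor (right A) v \<cdot>\<^bsub>C\<^esub> unit A X) (mor (right A) v' \<cdot>\<^bsub>C\<^esub> unit A X)"
    unfolding e using C.mk_hom[OF Obj_right(1)[OF v] R(4)[OF f'(3)]] R(6)[OF f'(1,3)] f'(4)
      C.Comp_assoc[OF AD(3)[OF C.X] R(4)[OF f'(1)] R(4)[OF f'(3)]] by simp
  show "und (mor (right B) f) = mor (right A) (und f)" by (simp add: e)
qed

lemma unit_hom:
  assumes "u \<in> Obj E"
  shows "unit B u \<in> hom E u (mor (right A) (mor (left A) u) \<cdot>\<^bsub>C\<^esub> unit A X)"
proof -
  have u: "u \<in> hom C X (Cod C u)" using assms C.Obj_E_iff by blast
  show ?thesis
    unfolding unit by (rule C.mk_hom[OF u AD(3) AD(4)[OF u, symmetric]]) (rule C.hom_ObjD(2)[OF u])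
qed

text \<open>That the counit of \<open>A\<close> lies under \<open>ob (left A) X\<close> means that
  transposing \<open>v\<close> and transposing back returns \<open>v\<close>.\<close>

lemma counit_hom:
  assumes "v \<in> Obj E'"
  shows "counit B v \<in> hom E' (mor (left A) (mor (right A) v \<cdot>\<^bsub>C\<^esub> unit A X)) v"
proof -
  have v: "v \<in> hom D (ob (left A) X) (Cod D v)" using assms D.Obj_E_iff by blast
  show ?thesis
    unfolding counit
    by (rule D.mk_hom[OF L(4)[OF Obj_right(1)[OF assms]] AD(5) adjunct_right_inverse[OF adj v C.X]])
      (rule D.hom_ObjD(2)[OF v])
qed

text \<open>By faithfulness every identity reduces to the corresponding one for \<open>A\<close> on
  underlying maps.\<close>

lemma adjunction_coslice: "adjunction E E' B"
proof -
  interpret E: category E by (rule C.category_E)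
  interpret E': category E' by (rule D.category_E)
  have hom: "u \<in> Obj E" "u' \<in> Obj E" if "f \<in> hom E u u'" for f u u' using that E.hom_ObjD by blast+
  have Cod_Obj: "Cod C u \<in> Obj C" if "u \<in> Obj E" for u
    using that C.Obj_E_iff C.hom_ObjD by blast
  have Cod_Obj': "Cod D v \<in> Obj D" if "v \<in> Obj E'" for v
    using that D.Obj_E_iff D.hom_ObjD by blast
  have Lf: "is_functor E E' (left B)"
    unfolding is_functor_def left_ob
  proof (intro conjI ballI allI)
    fix a assume a: "a \<in> Obj E"
    show "mor (left A) a \<in> Obj E'" using Obj_left a by blast
    show "mor (left B) (Id E a) = Id E' (mor (left A) a)"
      using L(5)[OF Cod_Obj[OF a]] Obj_left(2)[OF a] by (simp add: C.Id_E D.Id_E)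
  next
    fix a b f assume "f \<in> hom E a b"
    then show "mor (left B) f \<in> hom E' (mor (left A) a) (mor (left A) b)" by (rule left_hom)
  next
    fix a b c s t assume s: "s \<in> hom E a b" and t: "t \<in> hom E b c"
    show "mor (left B) (t \<cdot>\<^bsub>E\<^esub> s) = mor (left B) t \<cdot>\<^bsub>E'\<^esub> mor (left B) s"
      using D.eqI_E[OF left_hom(1)[OF E.Comp_hom[OF s t]] E'.Comp_hom[OF left_hom(1)[OF s] left_hom(1)[OF t]]]
        left_hom(2)[OF E.Comp_hom[OF s t]] left_hom(2)[OF s] left_hom(2)[OF t] C.und_Comp[OF s t]
        D.und_Comp[OF left_hom(1)[OF s] left_hom(1)[OF t]] L(6)[OF C.hom_ED(3)[OF s] C.hom_ED(3)[OF t]] by simp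
  qed (rule C.category_E, rule D.category_E)
  have Rf: "is_functor E' E (right B)"
    unfolding is_functor_def right_ob
  proof (intro conjI ballI allI)
    fix a assume a: "a \<in> Obj E'"
    show "mor (right A) a \<cdot>\<^bsub>C\<^esub> unit A X \<in> Obj E" using Obj_right a by blast
    show "mor (right B) (Id E' a) = Id E (mor (right A) a \<cdot>\<^bsub>C\<^esub> unit A X)"
      using R(5)[OF Cod_Obj'[OF a]] Obj_right(3)[OF a] by (simp add: C.Id_E D.Id_E)
  next
    fix a b f assume "f \<in> hom E' a b"
    then show "mor (right B) f \<in> hom E (mor (right A) a \<cdot>\<^bsub>C\<^esub> unit A X) (mor (right A) b \<cdot>\<^bsub>C\<^esub> unit A X)"
      by (rule right_hom)
  next
    fix a b c s t assume s: "s \<in> hom E' a b" and t: "t \<in> hom E' b c"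
    show "mor (right B) (t \<cdot>\<^bsub>E'\<^esub> s) = mor (right B) t \<cdot>\<^bsub>E\<^esub> mor (right B) s"
      using C.eqI_E[OF right_hom(1)[OF E'.Comp_hom[OF s t]] E.Comp_hom[OF right_hom(1)[OF s] right_hom(1)[OF t]]]
        right_hom(2)[OF E'.Comp_hom[OF s t]] right_hom(2)[OF s] right_hom(2)[OF t] D.und_Comp[OF s t]
        C.und_Comp[OF right_hom(1)[OF s] right_hom(1)[OF t]] R(6)[OF D.hom_ED(3)[OF s] D.hom_ED(3)[OF t]] by simp
  qed (rule D.category_E, rule C.category_E)
  show ?thesis
    unfolding adjunction_def left_ob right_ob
  proof (intro conjI ballI allI)
    show "is_functor E E' (left B)" by (rule Lf)
    show "is_functor E' E (right B)" by (rule Rf)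
  next
    fix u assume u: "u \<in> Obj E"
    show "unit B u \<in> hom E u (mor (right A) (mor (left A) u) \<cdot>\<^bsub>C\<^esub> unit A X)" by (rule unit_hom[OF u])
    note Lu = left_hom[OF unit_hom[OF u]] and \<epsilon> = counit_hom[OF Obj_left(1)[OF u]]
    show "counit B (mor (left A) u) \<cdot>\<^bsub>E'\<^esub> mor (left B) (unit B u) = Id E' (mor (left A) u)"
      using D.eqI_E[OF E'.Comp_hom[OF Lu(1) \<epsilon>] E'.Id_hom[OF Obj_left(1)[OF u]]]
        D.und_Comp[OF Lu(1) \<epsilon>] Lu(2) AD(7)[OF Cod_Obj[OF u]] Obj_left(2)[OF u]
      by (simp add: unit counit D.Id_E)
  next
    fix a b f assume f: "f \<in> hom E a b"
    note a = hom(1)[OF f] and b = hom(2)[OF f]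
    note RLf = right_hom[OF left_hom(1)[OF f]]
    show "mor (right B) (mor (left B) f) \<cdot>\<^bsub>E\<^esub> unit B a = unit B b \<cdot>\<^bsub>E\<^esub> f"
      using C.eqI_E[OF E.Comp_hom[OF unit_hom[OF a] RLf(1)] E.Comp_hom[OF f unit_hom[OF b]]]
        C.und_Comp[OF unit_hom[OF a] RLf(1)] C.und_Comp[OF f unit_hom[OF b]] RLf(2) left_hom(2)[OF f]
        AD(4)[OF C.hom_ED(3)[OF f]]
      by (simp add: unit)
  next
    fix v assume v: "v \<in> Obj E'"
    show "counit B v \<in> hom E' (mor (left A) (mor (right A) v \<cdot>\<^bsub>C\<^esub> unit A X)) v" by (rule counit_hom[OF v])
    note \<eta> = unit_hom[OF Obj_right(2)[OF v]] and R\<epsilon> = right_hom[OF counit_hom[OF v]]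
    show "mor (right B) (counit B v) \<cdot>\<^bsub>E\<^esub> unit B (mor (right A) v \<cdot>\<^bsub>C\<^esub> unit A X)
      = Id E (mor (right A) v \<cdot>\<^bsub>C\<^esub> unit A X)"
      using C.eqI_E[OF E.Comp_hom[OF \<eta> R\<epsilon>(1)] E.Id_hom[OF Obj_right(2)[OF v]]]
        C.und_Comp[OF \<eta> R\<epsilon>(1)] R\<epsilon>(2) AD(8)[OF Cod_Obj'[OF v]] Obj_right(3)[OF v]
      by (simp add: unit counit C.Id_E)
  next
    fix a b f assume f: "f \<in> hom E' a b"
    note \<epsilon> = counit_hom[OF E'.hom_ObjD(1)[OF f]] counit_hom[OF E'.hom_ObjD(2)[OF f]]
    note LRf = left_hom[OF right_hom(1)[OF f]]
    show "f \<cdot>\<^bsub>E'\<^esub> counit B a = counit B b \<cdot>\<^bsub>E'\<^esub> mor (left B) (mor (right B) f)"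
      using D.eqI_E[OF E'.Comp_hom[OF \<epsilon>(1) f] E'.Comp_hom[OF LRf(1) \<epsilon>(2)]]
        D.und_Comp[OF \<epsilon>(1) f] D.und_Comp[OF LRf(1) \<epsilon>(2)] LRf(2) right_hom(2)[OF f]
        AD(6)[OF D.hom_ED(3)[OF f]]
      by (simp add: counit)
  qed
qed

lemma quillen_equivalence_coslice: "quillen_equivalence E E' B"
proof -
  have *: "mor (left B) f \<in> Mor E' \<and> und (mor (left B) f) = mor (left A) (und f)" if "f \<in> Mor E" for f
    using left_hom[of f "Dom E f" "Cod E f"] that by (simp add: hom_def)
  have qa: "quillen_adjunction E E' B"
    unfolding quillen_adjunction_def
    using C.closed_model_category_E D.closed_model_category_E adjunction_coslice qe *
    by (auto simp: quillen_equivalence_def quillen_adjunction_def C.cof_E C.weq_E D.cof_E D.weq_E)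
  have "f \<in> weq E' \<longleftrightarrow> mor (right B) f \<cdot>\<^bsub>E\<^esub> unit B u \<in> weq E"
    if cu: "cofibrant E u" and fv: "fibrant E' v" and f: "f \<in> hom E' (mor (left A) u) v" for u v f
  proof -
    have uE: "u \<in> Obj E" using cu unfolding cofibrant_def by blast
    then have u: "u \<in> hom C X (Cod C u)" by (simp add: C.Obj_E_iff)
    have "cofibrant C (Cod C u)" using C.cofibrant_Cod[OF X_cofibrant u] C.cofibrant_E_iff cu by blast
    moreover have "und f \<in> hom D (ob (left A) (Cod C u)) (Cod D v)"
      using D.hom_ED(3)[OF f] Obj_left(2)[OF uE] by simp
    \<comment> \<open>The condition for \<open>A\<close> is used at the codomains of
      \<open>u\<close> and \<open>v\<close>; its right-hand side concerns exactly the map underlying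
      the adjunct of \<open>f\<close> in the coslice.\<close>
    ultimately have "und f \<in> weq D \<longleftrightarrow> mor (right A) (und f) \<cdot>\<^bsub>C\<^esub> unit A (Cod C u) \<in> weq C"
      using qe D.fibrant_E_Cod[OF fv] unfolding quillen_equivalence_def by blast
    moreover have "mor (right B) f \<cdot>\<^bsub>E\<^esub> unit B u \<in> Mor E"
      using category.Comp_hom[OF C.category_E unit_hom[OF uE] right_hom(1)[OF f]] by (simp add: hom_def)
    ultimately show ?thesis
      using C.und_Comp[OF unit_hom[OF uE] right_hom(1)[OF f]] right_hom(2)[OF f] f
      by (simp add: C.weq_E D.weq_E unit hom_def)
  qed
  then show ?thesis unfolding quillen_equivalence_def using qa by simp blast
qed

end

section \<open>Coslices and slices\<close>

lemma coslice_like_coslice: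
  assumes "closed_model_category C" "X \<in> Obj C"
  shows "coslice_like C X (coslice_model C X) (\<lambda>a \<alpha> b. (a, \<alpha>, b))"
  using assms
  by (auto simp: coslice_like_def coslice_like_axioms_def coslice_model_def coslice_def
      cat.extend_def model_cat.fields_def)

text \<open>The opposite exchanges domain and codomain but leaves the stored triples alone, so a
  morphism from \<open>a\<close> to \<open>b\<close> is stored as
  \<open>(b, \<alpha>, a)\<close>.\<close>

lemma coslice_like_slice:
  assumes "closed_model_category C" "X \<in> Obj C"
  shows "coslice_like (op_model C) X (op_model (slice_model C X)) (\<lambda>a \<alpha> b. (b, \<alpha>, a))"
  using assms closed_model_category_op[OF assms(1)]
  by (auto simp: coslice_like_def coslice_like_axioms_def slice_model_def slice_def
      cat.extend_def model_cat.fields_def)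

theorem proposition3p1:
  shows
   "(\<forall>(C :: ('o, 'm) model_cat) X Y g.
       closed_model_category C \<and> X \<in> Obj C \<and> Y \<in> Obj C \<and> g \<in> hom C X Y \<longrightarrow>
         (\<forall>i j. pushout_choice C g i j \<longrightarrow>
            quillen_adjunction (coslice_model C X) (coslice_model C Y) (cobase_change_adj C g i j) \<and>
            (quillen_equivalence (coslice_model C X) (coslice_model C Y) (cobase_change_adj C g i j)
               \<longleftrightarrow> (\<forall>u. cofibrant (coslice_model C X) u \<longrightarrow> j u \<in> weq C)) \<and>
            (\<forall>u. cofibrant (coslice_model C X) u \<longleftrightarrow> u \<in> cof C \<and> Dom C u = X)) \<and>
         (\<forall>p q. pullback_choice C g p q \<longrightarrow>
            quillen_adjunction (slice_model C X) (slice_model C Y) (base_change_adj C g p q) \<and>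
            (quillen_equivalence (slice_model C X) (slice_model C Y) (base_change_adj C g p q)
               \<longleftrightarrow> (\<forall>u. fibrant (slice_model C Y) u \<longrightarrow> q u \<in> weq C)) \<and>
            (\<forall>u. fibrant (slice_model C Y) u \<longleftrightarrow> u \<in> fib C \<and> Cod C u = Y)))
    \<and>
    (\<forall>(C :: ('o, 'm) model_cat) (D :: ('p, 'n) model_cat) A X Y.
       closed_model_category C \<and> closed_model_category D \<and> quillen_equivalence C D A \<and>
       X \<in> Obj C \<and> Y \<in> Obj D \<longrightarrow>
         (cofibrant C X \<longrightarrow>
            quillen_equivalence (coslice_model C X) (coslice_model D (ob (left A) X))
              (coslice_adj C D A X)) \<and>
         (fibrant D Y \<longrightarrow>
            quillen_equivalence (slice_model C (ob (right A) Y)) (slice_model D Y)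
              (slice_adj C D A Y)))"
proof (intro conjI allI impI; (elim conjE)?)
  fix C :: "('o, 'm) model_cat" and X Y g i j
  assume C: "closed_model_category C" and XY: "X \<in> Obj C" "Y \<in> Obj C" and g: "g \<in> hom C X Y"
    and po: "pushout_choice C g i j"
  interpret cobase_change C X Y "coslice_model C X" "coslice_model C Y" "\<lambda>a \<alpha> b. (a, \<alpha>, b)"
    g i j "cobase_change_adj C g i j"
    using C coslice_like_coslice XY g po
    by (auto simp: cobase_change_def cobase_change_axioms_def cobase_change_adj_def pushout_choice_def
        coslice_like.Obj_E[OF coslice_like_coslice] coslice_def hom_def)
  show "quillen_adjunction (coslice_model C X) (coslice_model C Y) (cobase_change_adj C g i j)"
    by (rule quillen_adjunction_cobase)
  show "quillen_equivalence (coslice_model C X) (coslice_model C Y) (cobase_change_adj C g i j)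
    \<longleftrightarrow> (\<forall>u. cofibrant (coslice_model C X) u \<longrightarrow> j u \<in> weq C)"
    by (rule quillen_equivalence_cobase_iff)
  show "cofibrant (coslice_model C X) u \<longleftrightarrow> u \<in> cof C \<and> Dom C u = X" for u
    by (rule X.cofibrant_E_iff)
next
  fix C :: "('o, 'm) model_cat" and X Y g p q
  assume C: "closed_model_category C" and XY: "X \<in> Obj C" "Y \<in> Obj C" and g: "g \<in> hom C X Y"
    and pb: "pullback_choice C g p q"
  let ?A = "base_change_adj C g p q"
  have "pushout (op_model C) g v (p v) (q v)" if "pullback C g v (p v) (q v)" for v
    using that unfolding pushout_def pullback_def by simp
  moreover have "Cod C g = Y" using g by (simp add: hom_def)
  moreover have "Obj (slice C Y) = Obj (slice_model C Y)"
    by (simp add: slice_model_def slice_def cat.extend_def)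
  ultimately have po: "pushout (op_model C) g v (p v) (q v)" if "v \<in> Obj (slice_model C Y)" for v
    using that pb unfolding pullback_choice_def by simp
  \<comment> \<open>In the opposite category \<open>g\<close> runs from \<open>Y\<close> to
    \<open>X\<close>, so \<open>g\<^sup>!\<close> takes the place of the left adjoint and
    \<open>q\<close> that of the cobase change \<open>j\<close>.\<close>
  interpret cobase_change "op_model C" Y X "op_model (slice_model C Y)" "op_model (slice_model C X)"
    "\<lambda>a \<alpha> b. (b, \<alpha>, a)" g p q "op_adj ?A"
    using closed_model_category_op[OF C] coslice_like_slice[OF C XY(1)] coslice_like_slice[OF C XY(2)] g po
    by (simp add: cobase_change_def cobase_change_axioms_def base_change_adj_def)
  show "quillen_adjunction (slice_model C X) (slice_model C Y) ?A"
    using quillen_adjunction_op[OF quillen_adjunction_cobase] by simp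
  show "quillen_equivalence (slice_model C X) (slice_model C Y) ?A
    \<longleftrightarrow> (\<forall>u. fibrant (slice_model C Y) u \<longrightarrow> q u \<in> weq C)"
    \<comment> \<open>Duality is an implication, so it is applied once to \<open>?A\<close> and once
      to \<open>op_adj ?A\<close>, where the double opposites collapse.\<close>
    using quillen_equivalence_cobase_iff quillen_equivalence_op[of "slice_model C X" "slice_model C Y" ?A]
      quillen_equivalence_op[of "op_model (slice_model C Y)" "op_model (slice_model C X)" "op_adj ?A"]
    by auto
  show "fibrant (slice_model C Y) u \<longleftrightarrow> u \<in> fib C \<and> Cod C u = Y" for u
    using X.cofibrant_E_iff by simp
next
  fix C :: "('o, 'm) model_cat" and D :: "('p, 'n) model_cat" and A X
  assume C: "closed_model_category C" and D: "closed_model_category D" and qe: "quillen_equivalence C D A"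
    and X: "X \<in> Obj C" and cX: "cofibrant C X"
  have A: "adjunction C D A" using qe unfolding quillen_equivalence_def quillen_adjunction_def by blast
  have SX: "ob (left A) X \<in> Obj D" by (rule is_functorD(3)[OF adjunctionD(1)[OF A] X])
  interpret coslice_quillen_equivalence C D A X "coslice_model C X" "coslice_model D (ob (left A) X)"
    "\<lambda>a \<alpha> b. (a, \<alpha>, b)" "\<lambda>a \<alpha> b. (a, \<alpha>, b)" "coslice_adj C D A X"
    using coslice_like_coslice[OF C X] coslice_like_coslice[OF D SX] qe cX
    by (simp add: coslice_quillen_equivalence_def coslice_quillen_equivalence_axioms_def coslice_adj_def Let_def)
  show "quillen_equivalence (coslice_model C X) (coslice_model D (ob (left A) X)) (coslice_adj C D A X)"
    by (rule quillen_equivalence_coslice)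
next
  fix C :: "('o, 'm) model_cat" and D :: "('p, 'n) model_cat" and A Y
  assume C: "closed_model_category C" and D: "closed_model_category D" and qe: "quillen_equivalence C D A"
    and Y: "Y \<in> Obj D" and fY: "fibrant D Y"
  have A: "adjunction C D A" using qe unfolding quillen_equivalence_def quillen_adjunction_def by blast
  have UY: "ob (right A) Y \<in> Obj C" by (rule is_functorD(3)[OF adjunctionD(2)[OF A] Y])
  \<comment> \<open>Dually \<open>Y\<close> is the base object, the right adjoint of
    \<open>A\<close> plays the left one, and fibrancy of \<open>Y\<close> supplies the required
    cofibrancy.\<close>
  interpret coslice_quillen_equivalence "op_model D" "op_model C" "op_adj A" Y "op_model (slice_model D Y)"
    "op_model (slice_model C (ob (right A) Y))" "\<lambda>a \<alpha> b. (b, \<alpha>, a)" "\<lambda>a \<alpha> b. (b, \<alpha>, a)"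
    "op_adj (slice_adj C D A Y)"
    using coslice_like_slice[OF D Y] coslice_like_slice[OF C UY] quillen_equivalence_op[OF qe] fY
    by (simp add: coslice_quillen_equivalence_def coslice_quillen_equivalence_axioms_def slice_adj_def Let_def)
  show "quillen_equivalence (slice_model C (ob (right A) Y)) (slice_model D Y) (slice_adj C D A Y)"
    using quillen_equivalence_op[OF quillen_equivalence_coslice] by simp
qed

end
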